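(* Let $d\in\mathbb{N}$, $p$ a kernel and $\xi$ noise as in the context. Let $\{\eta_t\}_{t\in\mathbb{Z}_+}$ be an $(\mathbb{R}^d)^{\mathbb{Z}^d}$-valued process evolving by \[\eta_{t+1}(x-e_i,x)=\sum_z p(0,z)\eta_t(x+z-e_i,x+z)+\xi_{t+1}(x)-\xi_{t+1}(x-e_i),\] with $\{\xi_s\}_{s\ge 1}$ independent of $\eta_0$. Assume $\eta_0(x-e_i,x)=u_i(x)+\zeta(x,i)$ for $x\in\mathbb{Z}^d$, $i=1,\dots,d$, where $u=(u_1,\dots,u_d)\in\mathcal{H}_d$ and $\zeta=\{\zeta(x)\}_{x\in\mathbb{Z}^d}$, $\zeta(x)=(\zeta(x,i))_{i\le d}$, is an $(\mathbb{R}^d)^{\mathbb{Z}^d}$-valued random configuration whose distribution is invariant and ergodic under the spatial shift group $\{\theta_{x}\}_{x\in\mathbb{Z}^d}$ and with $E\zeta(x)=0$. Let $\mu_t$ be the distribution of $\eta_t$. Then $\mu_t\to\pi_u$ weakly as $t\to\infty$.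
   Context: The kernel $p:\mathbb{Z}^d\to[0,1)$ satisfies $\sum_x p(x)=1$, $p(x)=0$ for $|x|>M$ for some $M<\infty$, and strong aperiodicity: for every $u\in\mathbb{Z}^d$ the smallest additive subgroup of $\mathbb{Z}^d$ containing $\{u+x:p(x)>0\}$ is $\mathbb{Z}^d$; $p(x,y)=p(y-x)$, $p^k$ the $k$-step transition. $\xi=\{\xi_t(x)\}_{t\in\mathbb{Z},x\in\mathbb{Z}^d}$ are i.i.d. real, mean zero, finite variance. $\mathcal{H}_d$ is the set of $u=(u_1,\dots,u_d)$, $u_i:\mathbb{Z}^d\to\mathbb{R}$ with $\sum_y p(x,y)u_i(y)=u_i(x)$ for all $x$. $\Delta_0(x-e_i,x)=\sum_{k\ge 0}\sum_z\xi_{-k}(z)(p^k(x,z)-p^k(x-e_i,z))$, and $\pi_u$ is the law of $\{u_i(x)+\Delta_0(x-e_i,x)\}_{x,i}$. The spatial shift is $(\theta_a\zeta)(x)=\zeta(x+a)$. Weak convergence is of probability measures on $(\mathbb{R}^d)^{\mathbb{Z}^d}$ with the product topology. *)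

theory Defs
  imports "HOL-Probability.Probability"
begin

text \<open>Lattice Z^d is int ^ 'd (the finite type 'd indexes the coordinates, d = CARD('d)).
 A configuration in (R^d)^(Z^d) is a map c :: int^'d => real^'d, with
 c x $ i standing for the value on the bond (x - e_i, x).\<close>

type_synonym ('d) config = "int ^ 'd \<Rightarrow> real ^ 'd"

definition unit_vec :: "'d::finite \<Rightarrow> int ^ 'd" where
  "unit_vec i = axis i 1"

definition subgroup_gen :: "'a::ab_group_add set \<Rightarrow> 'a set" where
  "subgroup_gen S = \<Inter>{G. S \<subseteq> G \<and> 0 \<in> G \<and> (\<forall>a\<in>G. \<forall>b\<in>G. a - b \<in> G)}"

text \<open>Kernel assumptions: p(x,y) = p(y - x).\<close>
definition kernel :: "(int ^ 'd::finite \<Rightarrow> real) \<Rightarrow> bool" where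
  "kernel p \<longleftrightarrow>
     (\<forall>x. 0 \<le> p x \<and> p x < 1) \<and>
     (p has_sum 1) UNIV \<and>
     (\<exists>R::int. \<forall>x. (\<exists>i. R < \<bar>x $ i\<bar>) \<longrightarrow> p x = 0) \<and>
     (\<forall>u. subgroup_gen {u + x | x. 0 < p x} = UNIV)"

fun pk :: "(int ^ 'd::finite \<Rightarrow> real) \<Rightarrow> nat \<Rightarrow> int ^ 'd \<Rightarrow> int ^ 'd \<Rightarrow> real" where
  "pk p 0 x y = (if x = y then 1 else 0)"
| "pk p (Suc k) x y = (\<Sum>\<^sub>\<infinity>z. p (z - x) * pk p k z y)"

definition harmonic_d :: "(int ^ 'd::finite \<Rightarrow> real) \<Rightarrow> (int ^ 'd \<Rightarrow> real ^ 'd) set" where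
  "harmonic_d p = {u. \<forall>x i. (\<Sum>\<^sub>\<infinity>y. p (y - x) * (u y $ i)) = u x $ i}"

definition Delta0 :: "(int ^ 'd::finite \<Rightarrow> real) \<Rightarrow> (int \<Rightarrow> int ^ 'd \<Rightarrow> 'a \<Rightarrow> real)
     \<Rightarrow> 'a \<Rightarrow> int ^ 'd \<Rightarrow> 'd \<Rightarrow> real" where
  "Delta0 p \<xi> \<omega> x i =
     (\<Sum>k. \<Sum>\<^sub>\<infinity>z. \<xi> (- int k) z \<omega> * (pk p k x z - pk p k (x - unit_vec i) z))"

definition pi_u :: "'a measure \<Rightarrow> (int ^ 'd::finite \<Rightarrow> real) \<Rightarrow> (int \<Rightarrow> int ^ 'd \<Rightarrow> 'a \<Rightarrow> real)
     \<Rightarrow> (int ^ 'd \<Rightarrow> real ^ 'd) \<Rightarrow> ('d config) measure" where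
  "pi_u M p \<xi> u = distr M borel (\<lambda>\<omega> x. \<chi> i. u x $ i + Delta0 p \<xi> \<omega> x i)"

definition shift :: "int ^ 'd::finite \<Rightarrow> 'd config \<Rightarrow> 'd config" where
  "shift a c = (\<lambda>x. c (x + a))"

definition shift_invariant :: "('d::finite config) measure \<Rightarrow> bool" where
  "shift_invariant \<nu> \<longleftrightarrow> (\<forall>a. distr \<nu> borel (shift a) = \<nu>)"

definition shift_ergodic :: "('d::finite config) measure \<Rightarrow> bool" where
  "shift_ergodic \<nu> \<longleftrightarrow>
     (\<forall>A \<in> sets borel. (\<forall>a. shift a -` A = A) \<longrightarrow> emeasure \<nu> A = 0 \<or> emeasure \<nu> A = 1)"

definition weak_conv :: "(nat \<Rightarrow> 'b::topological_space measure) \<Rightarrow> 'b measure \<Rightarrow> bool" where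
  "weak_conv \<mu> \<pi> \<longleftrightarrow>
     (\<forall>f :: 'b \<Rightarrow> real. continuous_on UNIV f \<and> bounded (range f) \<longrightarrow>
        (\<lambda>t. integral\<^sup>L (\<mu> t) f) \<longlonglongrightarrow> integral\<^sup>L \<pi> f)"

end

theory Submission
  imports Defs
begin

text \<open>Let A be the averaging operator of the kernel. Iterating the recursion gives
  \<open>\<eta>\<^sub>t = u + A\<^sup>t \<zeta> + (noise accumulated up to time t)\<close>.

  Everything rests on one energy identity. For a wide-sense stationary field Y, put
  \<open>X\<^sub>k = A\<^sup>k Y\<close>; then \<open>E X\<^sub>k(0)\<^sup>2 - E X\<^sub>k\<^sub>+\<^sub>1(0)\<^sup>2\<close> is half the average of
  \<open>E (X\<^sub>k(z) - X\<^sub>k(w))\<^sup>2\<close> over independent steps z, w of the walk. Telescoping, and using that the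
  differences of possible steps generate the lattice, all increments of \<open>X\<^sub>k\<close> are square summable in k.

  Applied to Y = \<open>\<zeta>\<close> (after truncation) this shows that \<open>A\<^sup>t \<zeta>\<close> is asymptotically shift invariant;
  the parallelogram law makes it Cauchy in L2, so by ergodicity it converges to 0 in L1. Applied to
  Y = \<open>\<xi>\<close> it shows that the series defining \<open>\<Delta>\<^sub>0\<close> has summable variances, hence converges almost
  surely by Kolmogorov's one-series theorem. Finally, by independence and the invariance of the noise
  under time shifts, \<open>\<eta>\<^sub>t\<close> has the law of \<open>u + A\<^sup>t \<zeta> + (the t-th partial sum of \<Delta>\<^sub>0)\<close> with the last
  two terms living on different factors of a product space, where along subsequences both converge almost
  surely.\<close>

subsection \<open>Averaging and the energy identity\<close>

text \<open>A finite sum over the support: linearity and exchange with integrals then carry no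
  summability conditions. \<open>infsum_kernel\<close> and \<open>infsum_kernel_shift\<close> match
  it with the infinite sums of the model.\<close>

definition avg :: "('g::ab_group_add \<Rightarrow> real) \<Rightarrow> ('g \<Rightarrow> real) \<Rightarrow> 'g \<Rightarrow> real" where
  "avg p f x = (\<Sum>z | p z \<noteq> 0. p z * f (x + z))"

lemma avg_diff: "avg p (\<lambda>y. f y - g y) x = avg p f x - avg p g x"
  by (simp add: avg_def right_diff_distrib sum_subtractf)

lemma avg_add: "avg p (\<lambda>y. f y + g y) x = avg p f x + avg p g x"
  by (simp add: avg_def distrib_left sum.distrib)

lemma avg_sum: "avg p (\<lambda>y. \<Sum>i\<in>I. f i y) x = (\<Sum>i\<in>I. avg p (f i) x)"
  unfolding avg_def sum_distrib_left by (rule sum.swap)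

lemma avg_translate: "avg p (\<lambda>y. f (y + a)) x = avg p f (x + a)"
  by (simp add: avg_def add_ac)

lemma funpow_avg_diff:
  "(avg p ^^ n) (\<lambda>y. f y - g y) x = (avg p ^^ n) f x - (avg p ^^ n) g x"
proof (induction n arbitrary: x)
  case (Suc n)
  then have "(avg p ^^ n) (\<lambda>y. f y - g y) = (\<lambda>y. (avg p ^^ n) f y - (avg p ^^ n) g y)" by auto
  then show ?case by (simp add: avg_diff)
qed simp

lemma funpow_avg_add:
  "(avg p ^^ n) (\<lambda>y. f y + g y) x = (avg p ^^ n) f x + (avg p ^^ n) g x"
proof (induction n arbitrary: x)
  case (Suc n)
  then have "(avg p ^^ n) (\<lambda>y. f y + g y) = (\<lambda>y. (avg p ^^ n) f y + (avg p ^^ n) g y)" by auto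
  then show ?case by (simp add: avg_add)
qed simp

lemma funpow_avg_translate: "(avg p ^^ n) (\<lambda>y. f (y + a)) x = (avg p ^^ n) f (x + a)"
proof (induction n arbitrary: x)
  case (Suc n)
  then have "(avg p ^^ n) (\<lambda>y. f (y + a)) = (\<lambda>y. (avg p ^^ n) f (y + a))" by auto
  then show ?case by (simp add: avg_translate)
qed simp

lemma borel_measurable_funpow_avg:
  assumes "\<And>z. (\<lambda>\<omega>. Y z \<omega>) \<in> borel_measurable M"
  shows "(\<lambda>\<omega>. (avg p ^^ n) (\<lambda>z. Y z \<omega>) x) \<in> borel_measurable M"
proof (induction n arbitrary: x)
  case (Suc n)
  then show ?case by (simp add: avg_def) measurable
qed (use assms in simp)

lemma integrable_avg:
  assumes "\<And>z. integrable M (Y z)"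
  shows "integrable M (\<lambda>\<omega>. avg p (\<lambda>z. Y z \<omega>) x)"
  unfolding avg_def by (intro Bochner_Integration.integrable_sum integrable_mult_right assms)

lemma integrable_funpow_avg:
  assumes "\<And>z. integrable M (Y z)"
  shows "integrable M (\<lambda>\<omega>. (avg p ^^ n) (\<lambda>z. Y z \<omega>) x)"
proof (induction n arbitrary: x)
  case (Suc n)
  then show ?case by (simp add: integrable_avg)
qed (use assms in simp)

section \<open>Second moments of averaged fields\<close>

lemma integrable_mult_square:
  fixes X Y :: "'a \<Rightarrow> real"
  assumes [measurable]: "X \<in> borel_measurable M" "Y \<in> borel_measurable M"
    and "integrable M (\<lambda>\<omega>. (X \<omega>)\<^sup>2)" "integrable M (\<lambda>\<omega>. (Y \<omega>)\<^sup>2)"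
  shows "integrable M (\<lambda>\<omega>. X \<omega> * Y \<omega>)"
proof (rule Bochner_Integration.integrable_bound)
  show "integrable M (\<lambda>\<omega>. (X \<omega>)\<^sup>2 + (Y \<omega>)\<^sup>2)" using assms by auto
  have "\<bar>a * b\<bar> \<le> a\<^sup>2 + b\<^sup>2" for a b :: real
    using sum_squares_bound[of "\<bar>a\<bar>" "\<bar>b\<bar>"] abs_ge_zero[of "a * b"]
    unfolding abs_mult power2_abs by linarith
  then show "AE \<omega> in M. norm (X \<omega> * Y \<omega>) \<le> norm ((X \<omega>)\<^sup>2 + (Y \<omega>)\<^sup>2)" by auto
qed measurable

definition L2 :: "'a measure \<Rightarrow> ('a \<Rightarrow> real) set" where
  "L2 M = {X. X \<in> borel_measurable M \<and> integrable M (\<lambda>\<omega>. (X \<omega>)\<^sup>2)}"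

lemma L2_mult: "X \<in> L2 M \<Longrightarrow> Y \<in> L2 M \<Longrightarrow> integrable M (\<lambda>\<omega>. X \<omega> * Y \<omega>)"
  unfolding L2_def by (auto intro: integrable_mult_square)

lemma L2_measurable [measurable_dest]: "X \<in> L2 M \<Longrightarrow> X \<in> borel_measurable M"
  by (simp add: L2_def)

lemma L2_square: "X \<in> L2 M \<Longrightarrow> integrable M (\<lambda>\<omega>. (X \<omega>)\<^sup>2)"
  by (simp add: L2_def)

lemma L2_add: "X \<in> L2 M \<Longrightarrow> Y \<in> L2 M \<Longrightarrow> (\<lambda>\<omega>. X \<omega> + Y \<omega>) \<in> L2 M"
  using L2_mult[of X M Y] by (auto simp: L2_def power2_sum mult.assoc)

lemma L2_cmult: "X \<in> L2 M \<Longrightarrow> (\<lambda>\<omega>. c * X \<omega>) \<in> L2 M"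
  by (auto simp: L2_def power_mult_distrib)

lemma L2_diff: "X \<in> L2 M \<Longrightarrow> Y \<in> L2 M \<Longrightarrow> (\<lambda>\<omega>. X \<omega> - Y \<omega>) \<in> L2 M"
  using L2_add[OF _ L2_cmult[of Y M "-1"], of X] by simp

lemma L2_sum: "(\<And>i. i \<in> I \<Longrightarrow> X i \<in> L2 M) \<Longrightarrow> (\<lambda>\<omega>. \<Sum>i\<in>I. X i \<omega>) \<in> L2 M"
proof (induction I rule: infinite_finite_induct)
  case (insert x F)
  then show ?case by (auto intro!: L2_add)
qed (auto simp: L2_def)

lemma (in finite_measure) L2_integrable: "X \<in> L2 M \<Longrightarrow> integrable M X"
  using L2_mult[of X M "\<lambda>_. 1"] by (auto simp: L2_def)

lemma L2_avg: "(\<And>z. Y z \<in> L2 M) \<Longrightarrow> (\<lambda>\<omega>. avg p (\<lambda>z. Y z \<omega>) x) \<in> L2 M"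
  unfolding avg_def by (intro L2_sum L2_cmult)

lemma L2_funpow_avg: "(\<And>z. Y z \<in> L2 M) \<Longrightarrow> (\<lambda>\<omega>. (avg p ^^ n) (\<lambda>z. Y z \<omega>) x) \<in> L2 M"
proof (induction n arbitrary: x)
  case (Suc n)
  then show ?case by (simp add: L2_avg)
qed simp

lemma integral_avg_mult_avg:
  assumes "\<And>z. Y z \<in> L2 M" "\<And>z. Y' z \<in> L2 M"
  shows "(\<integral>\<omega>. avg p (\<lambda>z. Y z \<omega>) x * avg p (\<lambda>z. Y' z \<omega>) y \<partial>M)
    = (\<Sum>z | p z \<noteq> 0. \<Sum>w | p w \<noteq> 0. p z * p w * (\<integral>\<omega>. Y (x + z) \<omega> * Y' (y + w) \<omega> \<partial>M))"
proof -
  have "(\<integral>\<omega>. avg p (\<lambda>z. Y z \<omega>) x * avg p (\<lambda>z. Y' z \<omega>) y \<partial>M)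
     = (\<integral>\<omega>. (\<Sum>z | p z \<noteq> 0. \<Sum>w | p w \<noteq> 0. p z * p w * (Y (x + z) \<omega> * Y' (y + w) \<omega>)) \<partial>M)"
    unfolding avg_def sum_product
    by (intro Bochner_Integration.integral_cong sum.cong refl) (simp only: mult_ac)
  also have "\<dots> = (\<Sum>z | p z \<noteq> 0. \<Sum>w | p w \<noteq> 0. p z * p w * (\<integral>\<omega>. Y (x + z) \<omega> * Y' (y + w) \<omega> \<partial>M))"
    by (simp only: Bochner_Integration.integral_sum integral_mult_right_zero integrable_mult_right Bochner_Integration.integrable_sum assms L2_mult)
  finally show ?thesis .
qed

text \<open>By \<open>integral_avg_mult_avg\<close> the second moments after one more averaging are
  a linear function of those before, so the initial second moments determine all later ones. This
  allows the noise at time \<open>- int k\<close> to be traded for the noise at time 0.\<close>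

lemma covariance_funpow_avg_cong:
  assumes "\<And>z. Y z \<in> L2 M" "\<And>z. Y' z \<in> L2 M'"
    and "\<And>x y. (\<integral>\<omega>. Y x \<omega> * Y y \<omega> \<partial>M) = (\<integral>\<omega>. Y' x \<omega> * Y' y \<omega> \<partial>M')"
  shows "(\<integral>\<omega>. (avg p ^^ n) (\<lambda>z. Y z \<omega>) x * (avg p ^^ n) (\<lambda>z. Y z \<omega>) y \<partial>M)
       = (\<integral>\<omega>. (avg p ^^ n) (\<lambda>z. Y' z \<omega>) x * (avg p ^^ n) (\<lambda>z. Y' z \<omega>) y \<partial>M')"
proof (induction n arbitrary: x y)
  case (Suc n)
  show ?case
    by (simp add: integral_avg_mult_avg L2_funpow_avg assms(1,2) Suc)
qed (use assms(3) in simp)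

section \<open>Fields with translation invariant second moments\<close>

definition wide_stationary :: "'a measure \<Rightarrow> ('g::ab_group_add \<Rightarrow> 'a \<Rightarrow> real) \<Rightarrow> bool" where
  "wide_stationary M Y \<longleftrightarrow> (\<forall>x. Y x \<in> L2 M) \<and>
     (\<forall>x y a. (\<integral>\<omega>. Y (x + a) \<omega> * Y (y + a) \<omega> \<partial>M) = (\<integral>\<omega>. Y x \<omega> * Y y \<omega> \<partial>M))"

lemma wide_stationary_L2: "wide_stationary M Y \<Longrightarrow> Y x \<in> L2 M"
  by (simp add: wide_stationary_def)

lemma integral_square_diff:
  assumes "X \<in> L2 M" "Y \<in> L2 M"
  shows "(\<integral>\<omega>. (X \<omega> - Y \<omega>)\<^sup>2 \<partial>M) = (\<integral>\<omega>. X \<omega> * X \<omega> \<partial>M) + (\<integral>\<omega>. Y \<omega> * Y \<omega> \<partial>M) - 2 * (\<integral>\<omega>. X \<omega> * Y \<omega> \<partial>M)"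
proof -
  have "(\<integral>\<omega>. (X \<omega> - Y \<omega>)\<^sup>2 \<partial>M) = (\<integral>\<omega>. X \<omega> * X \<omega> + Y \<omega> * Y \<omega> - 2 * (X \<omega> * Y \<omega>) \<partial>M)"
    by (simp add: power2_eq_square algebra_simps)
  also have "\<dots> = (\<integral>\<omega>. X \<omega> * X \<omega> \<partial>M) + (\<integral>\<omega>. Y \<omega> * Y \<omega> \<partial>M) - 2 * (\<integral>\<omega>. X \<omega> * Y \<omega> \<partial>M)"
    using assms by (simp add: L2_mult)
  finally show ?thesis .
qed

lemma wide_stationary_square_diff:
  assumes "wide_stationary M Y"
  shows "(\<integral>\<omega>. (Y (x + a) \<omega> - Y (y + a) \<omega>)\<^sup>2 \<partial>M) = (\<integral>\<omega>. (Y x \<omega> - Y y \<omega>)\<^sup>2 \<partial>M)"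
  using assms by (simp add: integral_square_diff wide_stationary_def)

lemma wide_stationary_square:
  assumes "wide_stationary M Y"
  shows "(\<integral>\<omega>. Y x \<omega> * Y x \<omega> \<partial>M) = (\<integral>\<omega>. Y 0 \<omega> * Y 0 \<omega> \<partial>M)"
  using assms unfolding wide_stationary_def by (metis add_0)

lemma wide_stationary_avg:
  assumes "wide_stationary M Y"
  shows "wide_stationary M (\<lambda>x \<omega>. avg p (\<lambda>z. Y z \<omega>) x)"
proof -
  have "(\<integral>\<omega>. Y (x + a + z) \<omega> * Y (y + a + w) \<omega> \<partial>M) = (\<integral>\<omega>. Y (x + z) \<omega> * Y (y + w) \<omega> \<partial>M)" for x y a z w
    using assms unfolding wide_stationary_def add.assoc add.commute[of a]
    unfolding add.assoc[symmetric] by blast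
  then show ?thesis
    unfolding wide_stationary_def
    by (simp only: L2_avg integral_avg_mult_avg wide_stationary_L2[OF assms]) simp
qed

lemma wide_stationary_funpow_avg:
  "wide_stationary M Y \<Longrightarrow> wide_stationary M (\<lambda>x \<omega>. (avg p ^^ n) (\<lambda>z. Y z \<omega>) x)"
proof (induction n)
  case (Suc n)
  then show ?case using wide_stationary_avg[OF Suc.IH] by simp
qed simp

section \<open>Energy lost by averaging\<close>

locale walk =
  fixes p :: "'g::ab_group_add \<Rightarrow> real"
  assumes p_nonneg: "0 \<le> p z"
    and p_finite: "finite {z. p z \<noteq> 0}"
    and p_sum: "(\<Sum>z | p z \<noteq> 0. p z) = 1"
begin

text \<open>Polarisation and stationarity write each E Y(z) Y(w) as E Y(0)^2 minus half the mean
  squared increment. The weights \<open>p z * p w\<close> have total mass one, so the constant part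
  survives with factor one.\<close>

lemma energy_identity:
  assumes Y: "wide_stationary M Y"
  shows "(\<integral>\<omega>. avg p (\<lambda>z. Y z \<omega>) 0 * avg p (\<lambda>z. Y z \<omega>) 0 \<partial>M) =
    (\<integral>\<omega>. Y 0 \<omega> * Y 0 \<omega> \<partial>M)
    - (\<Sum>z | p z \<noteq> 0. \<Sum>w | p w \<noteq> 0. p z * p w * (\<integral>\<omega>. (Y z \<omega> - Y w \<omega>)\<^sup>2 \<partial>M)) / 2"
proof -
  let ?R = "\<integral>\<omega>. Y 0 \<omega> * Y 0 \<omega> \<partial>M"
  have L: "Y z \<in> L2 M" for z using Y by (rule wide_stationary_L2)
  have *: "(\<integral>\<omega>. Y z \<omega> * Y w \<omega> \<partial>M) = ?R - (\<integral>\<omega>. (Y z \<omega> - Y w \<omega>)\<^sup>2 \<partial>M) / 2" for z w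
    using integral_square_diff[OF L L, of z w] wide_stationary_square[OF Y, of z]
      wide_stationary_square[OF Y, of w] by (simp add: field_simps)
  have **: "p z * p w * (\<integral>\<omega>. Y z \<omega> * Y w \<omega> \<partial>M) = p z * p w * ?R
      - p z * p w * (\<integral>\<omega>. (Y z \<omega> - Y w \<omega>)\<^sup>2 \<partial>M) / 2" for z w
    by (subst *) (simp add: right_diff_distrib)
  have "(\<Sum>z | p z \<noteq> 0. \<Sum>w | p w \<noteq> 0. p z * p w * ?R) = (\<Sum>z | p z \<noteq> 0. \<Sum>w | p w \<noteq> 0. p z * p w) * ?R"
    by (simp add: sum_distrib_right)
  also have "\<dots> = ?R"
    by (simp add: sum_product[symmetric] p_sum)
  finally show ?thesis
    unfolding integral_avg_mult_avg[OF L L] add_0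
    by (simp only: ** sum_subtractf sum_divide_distrib)
qed

text \<open>The energies are non-negative, so the successive losses telescope to at most the initial
  energy. Each loss contains the squared increment between \<open>z\<close> and \<open>w\<close>
  with weight at least \<open>p z * p w / 2\<close>.\<close>

lemma summable_energy:
  assumes Y: "wide_stationary M Y" and "p z > 0" "p w > 0"
  defines "X \<equiv> \<lambda>k x \<omega>. (avg p ^^ k) (\<lambda>y. Y y \<omega>) x"
  shows "summable (\<lambda>k. \<integral>\<omega>. (X k z \<omega> - X k w \<omega>)\<^sup>2 \<partial>M)"
proof -
  define E where "E k = (\<integral>\<omega>. X k 0 \<omega> * X k 0 \<omega> \<partial>M)" for k
  define V where "V k z w = (\<integral>\<omega>. (X k z \<omega> - X k w \<omega>)\<^sup>2 \<partial>M)" for k z w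
  have V0: "V k z w \<ge> 0" for k z w by (simp add: V_def)
  have E0: "E k \<ge> 0" for k by (simp add: E_def)
  have X: "wide_stationary M (X k)" for k
    unfolding X_def using Y by (rule wide_stationary_funpow_avg)
  have step: "E (Suc k) = E k - (\<Sum>z | p z \<noteq> 0. \<Sum>w | p w \<noteq> 0. p z * p w * V k z w) / 2" for k
    using energy_identity[OF X, of k] by (simp add: E_def X_def V_def)
  have "V k z w * (p z * p w) \<le> 2 * (E k - E (Suc k))" for k
  proof -
    have "p z * p w * V k z w \<le> (\<Sum>w | p w \<noteq> 0. p z * p w * V k z w)"
      using assms by (intro member_le_sum) (auto simp: p_finite p_nonneg V0)
    also have "\<dots> \<le> (\<Sum>z | p z \<noteq> 0. \<Sum>w | p w \<noteq> 0. p z * p w * V k z w)"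
      using assms by (intro member_le_sum[of z _ "\<lambda>z. \<Sum>w | p w \<noteq> 0. p z * p w * V k z w"])
        (auto simp: p_finite p_nonneg V0 intro!: sum_nonneg)
    finally show ?thesis using step[of k] by (simp add: mult_ac)
  qed
  then have le: "V k z w \<le> 2 / (p z * p w) * (E k - E (Suc k))" for k
    using assms(2,3) by (simp add: field_simps)
  have "(\<Sum>k<n. V k z w) \<le> 2 / (p z * p w) * E 0" for n
  proof -
    have "(\<Sum>k<n. V k z w) \<le> (\<Sum>k<n. 2 / (p z * p w) * (E k - E (Suc k)))"
      by (intro sum_mono le)
    also have "\<dots> = 2 / (p z * p w) * (E 0 - E n)"
      unfolding sum_distrib_left[symmetric] sum_lessThan_telescope' ..
    also have "\<dots> \<le> 2 / (p z * p w) * E 0"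
      using assms(2,3) E0 by (intro mult_left_mono) auto
    finally show ?thesis .
  qed
  then have "summable (\<lambda>k. V k z w)"
    by (intro summableI_nonneg_bounded[of _ "2 / (p z * p w) * E 0"] V0)
  then show ?thesis by (simp add: V_def)
qed

text \<open>The shifts along which the increments are square summable form a group, because the
  increments are stationary and the L2 norm obeys the triangle inequality.\<close>
lemma summable_square_increment:
  assumes Y: "wide_stationary M Y"
    and gen: "\<And>u. subgroup_gen {u + x | x. 0 < p x} = UNIV"
  defines "X \<equiv> \<lambda>k x \<omega>. (avg p ^^ k) (\<lambda>y. Y y \<omega>) x"
  shows "summable (\<lambda>k. \<integral>\<omega>. (X k x \<omega> - X k y \<omega>)\<^sup>2 \<partial>M)"
proof -
  define V where "V k a = (\<integral>\<omega>. (X k a \<omega> - X k 0 \<omega>)\<^sup>2 \<partial>M)" for k a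
  have X: "wide_stationary M (X k)" for k
    unfolding X_def using Y by (rule wide_stationary_funpow_avg)
  have L: "X k z \<in> L2 M" for k z using X by (rule wide_stationary_L2)
  have V: "(\<integral>\<omega>. (X k x \<omega> - X k y \<omega>)\<^sup>2 \<partial>M) = V k (x - y)" for k x y
    using wide_stationary_square_diff[OF X, of k "x - y" y 0] by (simp add: V_def)
  define G where "G = {a. summable (\<lambda>k. V k a)}"
  have "\<exists>w. p w > 0"
    using p_sum p_nonneg by (metis (mono_tags, lifting) less_eq_real_def sum.neutral zero_neq_one)
  then obtain w where w: "p w > 0" ..
  \<comment> \<open>The choice u = -w turns the generators into differences x - w of two possible
    steps, which are the increments that \<open>summable_energy\<close> controls.\<close>
  have "{(- w) + x | x. 0 < p x} \<subseteq> G"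
  proof clarify
    fix x assume "0 < p x"
    then have "summable (\<lambda>k. \<integral>\<omega>. (X k x \<omega> - X k w \<omega>)\<^sup>2 \<partial>M)"
      unfolding X_def using w by (intro summable_energy Y)
    then show "- w + x \<in> G" by (simp add: G_def V)
  qed
  moreover have "0 \<in> G" by (simp add: G_def V_def)
  moreover have "a - b \<in> G" if "a \<in> G" "b \<in> G" for a b
  proof -
    have "V k (a - b) \<le> 2 * V k a + 2 * V k b" for k
    proof -
      have int: "integrable M (\<lambda>\<omega>. (X k x \<omega> - X k y \<omega>)\<^sup>2)" for x y
        by (intro L2_square L2_diff L)
      have "V k (a - b) = (\<integral>\<omega>. (X k (a - b) \<omega> - X k 0 \<omega>)\<^sup>2 \<partial>M)" by (simp add: V)
      \<comment> \<open>The intermediate site is -b because a - b differs from it by a, and 0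
        differs from it by b.\<close>
      also have "\<dots> \<le> (\<integral>\<omega>. 2 * (X k (a - b) \<omega> - X k (- b) \<omega>)\<^sup>2 + 2 * (X k 0 \<omega> - X k (- b) \<omega>)\<^sup>2 \<partial>M)"
      proof (intro integral_mono)
        fix \<omega>
        have "(s - t)\<^sup>2 \<le> 2 * (s - r)\<^sup>2 + 2 * (t - r)\<^sup>2" for s t r :: real
          using zero_le_power2[of "(s - r) + (t - r)"] by (simp add: power2_eq_square algebra_simps)
        then show "(X k (a - b) \<omega> - X k 0 \<omega>)\<^sup>2
          \<le> 2 * (X k (a - b) \<omega> - X k (- b) \<omega>)\<^sup>2 + 2 * (X k 0 \<omega> - X k (- b) \<omega>)\<^sup>2" .
      qed (intro int Bochner_Integration.integrable_add integrable_mult_right)+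
      also have "\<dots> = 2 * V k a + 2 * V k b"
        by (simp add: int V)
      finally show ?thesis .
    qed
    moreover have "summable (\<lambda>k. 2 * V k a + 2 * V k b)"
      using that by (intro summable_add summable_mult) (auto simp: G_def)
    ultimately show ?thesis
      unfolding G_def mem_Collect_eq
      by (elim summable_comparison_test'[where N=0]) (auto simp: V_def)
  qed
  ultimately have "subgroup_gen {(- w) + x | x. 0 < p x} \<subseteq> G"
    unfolding subgroup_gen_def by (intro Inter_lower) auto
  then have "x - y \<in> G" unfolding gen by auto
  then show ?thesis by (simp add: G_def V)
qed

end

subsection \<open>Kolmogorov's one-series theorem\<close>

lemma L2_mono:
  assumes "Y \<in> L2 M" "X \<in> borel_measurable M" "\<And>\<omega>. \<bar>X \<omega>\<bar> \<le> \<bar>Y \<omega>\<bar>"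
  shows "X \<in> L2 M"
proof -
  have "integrable M (\<lambda>\<omega>. (X \<omega>)\<^sup>2)"
    using L2_square[OF assms(1)] assms(2,3)
    by (elim Bochner_Integration.integrable_bound) (auto simp: abs_le_square_iff)
  then show ?thesis using assms(2) by (simp add: L2_def)
qed

text \<open>Stopping the partial sums at their first exit keeps the increments orthogonal and remembers the
  exit at the final index, so Chebyshev's inequality there controls the maximum.\<close>
fun frozen_sum :: "real \<Rightarrow> nat \<Rightarrow> (nat \<Rightarrow> real) \<Rightarrow> nat \<Rightarrow> real" where
  "frozen_sum c m x 0 = 0"
| "frozen_sum c m x (Suc j) =
     frozen_sum c m x j + (if \<bar>frozen_sum c m x j\<bar> < c then x (m + j) else 0)"

lemma frozen_sum_stays: "c \<le> \<bar>frozen_sum c m x j\<bar> \<Longrightarrow> c \<le> \<bar>frozen_sum c m x (j + i)\<bar>"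
  by (induction i) auto

lemma frozen_sum_eq: "(\<And>i. i < j \<Longrightarrow> \<bar>\<Sum>k<i. x (m + k)\<bar> < c) \<Longrightarrow> frozen_sum c m x j = (\<Sum>k<j. x (m + k))"
  by (induction j) auto

lemma frozen_sum_exit:
  assumes "c \<le> \<bar>\<Sum>k<j. x (m + k)\<bar>" "j \<le> n"
  shows "c \<le> \<bar>frozen_sum c m x n\<bar>"
proof -
  define i where "i = (LEAST j. c \<le> \<bar>\<Sum>k<j. x (m + k)\<bar>)"
  have i: "c \<le> \<bar>\<Sum>k<i. x (m + k)\<bar>" "i \<le> j"
    unfolding i_def using assms(1) by (auto intro: LeastI Least_le)
  have "frozen_sum c m x i = (\<Sum>k<i. x (m + k))"
    using not_less_Least[of _ "\<lambda>j. c \<le> \<bar>\<Sum>k<j. x (m + k)\<bar>"]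
    by (intro frozen_sum_eq) (auto simp: i_def not_le)
  with i assms(2) frozen_sum_stays[of c m x i "n - i"] show ?thesis by simp
qed

lemma frozen_sum_cong:
  "(\<And>k. m \<le> k \<Longrightarrow> k < m + j \<Longrightarrow> x k = y k) \<Longrightarrow> frozen_sum c m x j = frozen_sum c m y j"
  by (induction j) auto

text \<open>Measurability is asked only of the entries that are read, so that the lemma applies on
  the product space over \<open>{m..<m + j}\<close>.\<close>

lemma borel_measurable_frozen_sum:
  assumes "\<And>k. m \<le> k \<Longrightarrow> k < m + j \<Longrightarrow> (\<lambda>\<omega>. X k \<omega>) \<in> borel_measurable N"
  shows "(\<lambda>\<omega>. frozen_sum c m (\<lambda>k. X k \<omega>) j) \<in> borel_measurable N"
  using assms
proof (induction j)
  case (Suc j)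
  then have [measurable]: "(\<lambda>\<omega>. frozen_sum c m (\<lambda>k. X k \<omega>) j) \<in> borel_measurable N"
    "X (m + j) \<in> borel_measurable N" by auto
  show ?case by simp
qed simp

context prob_space
begin

lemma frozen_sum_L2:
  assumes X: "\<And>k. X k \<in> L2 M"
  shows "(\<lambda>\<omega>. frozen_sum c m (\<lambda>k. X k \<omega>) j) \<in> L2 M"
proof (induction j)
  case (Suc j)
  have [measurable]: "(\<lambda>\<omega>. frozen_sum c m (\<lambda>k. X k \<omega>) j) \<in> borel_measurable M"
    "X (m + j) \<in> borel_measurable M"
    using Suc X by (auto dest: L2_measurable)
  have "(\<lambda>\<omega>. if \<bar>frozen_sum c m (\<lambda>k. X k \<omega>) j\<bar> < c then X (m + j) \<omega> else 0) \<in> L2 M"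
    by (rule L2_mono[OF X[of "m + j"]]) auto
  from L2_add[OF Suc this] show ?case by simp
qed (simp add: L2_def)

text \<open>The cross term vanishes: it is the product of a function of earlier terms with the
  independent centred term \<open>X (m + j)\<close>. Freezing can only decrease the square of an
  increment.\<close>

lemma frozen_sum_second_moment:
  assumes indep: "indep_vars (\<lambda>_. borel) X UNIV"
    and X: "\<And>k. X k \<in> L2 M" and mean: "\<And>k. expectation (X k) = 0"
  shows "expectation (\<lambda>\<omega>. (frozen_sum c m (\<lambda>k. X k \<omega>) j)\<^sup>2) \<le> (\<Sum>k<j. expectation (\<lambda>\<omega>. (X (m + k) \<omega>)\<^sup>2))"
proof (induction j)
  case (Suc j)
  let ?T = "\<lambda>\<omega>. frozen_sum c m (\<lambda>k. X k \<omega>) j"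
  let ?D = "\<lambda>\<omega>. if \<bar>?T \<omega>\<bar> < c then X (m + j) \<omega> else 0"
  \<comment> \<open>Moving the indicator from \<open>?D\<close> to \<open>?W\<close> gives
    \<open>?T * ?D = ?W * X (m + j)\<close>, where \<open>?W\<close> depends only on earlier
    terms.\<close>
  let ?W = "\<lambda>\<omega>. if \<bar>?T \<omega>\<bar> < c then ?T \<omega> else 0"
  have T: "?T \<in> L2 M" by (rule frozen_sum_L2[OF X])
  have [measurable]: "?T \<in> borel_measurable M" "X (m + j) \<in> borel_measurable M"
    using T X by (auto dest: L2_measurable)
  have D: "?D \<in> L2 M" by (rule L2_mono[OF X[of "m + j"]]) auto
  have W: "?W \<in> L2 M" by (rule L2_mono[OF T]) auto
  let ?A = "{m..<m + j}"
  let ?F = "\<lambda>x. if \<bar>frozen_sum c m x j\<bar> < c then frozen_sum c m x j else 0"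
  have [measurable]: "(\<lambda>x. frozen_sum c m x j) \<in> borel_measurable (PiM ?A (\<lambda>_. borel))"
    by (rule borel_measurable_frozen_sum) (auto intro: measurable_component_singleton)
  have "indep_var borel (?F \<circ> (\<lambda>\<omega>. \<lambda>k\<in>?A. X k \<omega>)) borel ((\<lambda>x. x (m + j)) \<circ> (\<lambda>\<omega>. \<lambda>k\<in>{m + j}. X k \<omega>))"
    by (rule indep_var_compose[OF indep_var_restrict[OF indep]]) auto
  moreover have "?F \<circ> (\<lambda>\<omega>. \<lambda>k\<in>?A. X k \<omega>) = ?W"
  proof
    fix \<omega>
    have "frozen_sum c m (\<lambda>k\<in>?A. X k \<omega>) j = ?T \<omega>" by (rule frozen_sum_cong) auto
    then show "(?F \<circ> (\<lambda>\<omega>. \<lambda>k\<in>?A. X k \<omega>)) \<omega> = ?W \<omega>" by simp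
  qed
  moreover have "(\<lambda>x. x (m + j)) \<circ> (\<lambda>\<omega>. \<lambda>k\<in>{m + j}. X k \<omega>) = X (m + j)"
    by auto
  ultimately have "indep_var borel ?W borel (X (m + j))" by metis
  then have "expectation (\<lambda>\<omega>. ?W \<omega> * X (m + j) \<omega>) = expectation ?W * expectation (X (m + j))"
    by (rule indep_var_lebesgue_integral) (auto intro: L2_integrable W X)
  then have 0: "expectation (\<lambda>\<omega>. ?W \<omega> * X (m + j) \<omega>) = 0" using mean by simp
  have "expectation (\<lambda>\<omega>. (frozen_sum c m (\<lambda>k. X k \<omega>) (Suc j))\<^sup>2)
      = expectation (\<lambda>\<omega>. (?T \<omega>)\<^sup>2 + (?D \<omega>)\<^sup>2 + 2 * (?W \<omega> * X (m + j) \<omega>))"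
    by (intro Bochner_Integration.integral_cong) (auto simp: power2_sum)
  also have "\<dots> = expectation (\<lambda>\<omega>. (?T \<omega>)\<^sup>2) + expectation (\<lambda>\<omega>. (?D \<omega>)\<^sup>2)"
    using L2_square[OF T] L2_square[OF D] L2_mult[OF W X] 0 by simp
  also have "expectation (\<lambda>\<omega>. (?D \<omega>)\<^sup>2) \<le> expectation (\<lambda>\<omega>. (X (m + j) \<omega>)\<^sup>2)"
    by (intro integral_mono L2_square D X) auto
  finally show ?case using Suc by simp
qed simp

lemma kolmogorov_maximal:
  fixes m :: nat
  assumes indep: "indep_vars (\<lambda>_. borel) X UNIV"
    and X: "\<And>k. X k \<in> L2 M" and mean: "\<And>k. expectation (X k) = 0" and c: "c > 0"
  shows "prob {\<omega> \<in> space M. \<exists>j\<le>n. c \<le> \<bar>\<Sum>k<j. X (m + k) \<omega>\<bar>} \<le> (\<Sum>k<n. expectation (\<lambda>\<omega>. (X (m + k) \<omega>)\<^sup>2)) / c\<^sup>2"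
proof -
  let ?T = "\<lambda>\<omega>. frozen_sum c m (\<lambda>k. X k \<omega>) n"
  have T: "?T \<in> L2 M" by (rule frozen_sum_L2[OF X])
  have [measurable]: "?T \<in> borel_measurable M" using T by (rule L2_measurable)
  have "prob {\<omega> \<in> space M. \<exists>j\<le>n. c \<le> \<bar>\<Sum>k<j. X (m + k) \<omega>\<bar>} \<le> prob {\<omega> \<in> space M. c\<^sup>2 \<le> (?T \<omega>)\<^sup>2}"
  proof (rule finite_measure_mono)
    show "{\<omega> \<in> space M. \<exists>j\<le>n. c \<le> \<bar>\<Sum>k<j. X (m + k) \<omega>\<bar>} \<subseteq> {\<omega> \<in> space M. c\<^sup>2 \<le> (?T \<omega>)\<^sup>2}"
    proof clarify
      fix \<omega> j assume "j \<le> n" "c \<le> \<bar>\<Sum>k<j. X (m + k) \<omega>\<bar>"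
      then have "c \<le> \<bar>?T \<omega>\<bar>" by (intro frozen_sum_exit)
      then show "c\<^sup>2 \<le> (?T \<omega>)\<^sup>2" using c abs_le_square_iff[of c "?T \<omega>"] by simp
    qed
  qed measurable
  also have "\<dots> \<le> expectation (\<lambda>\<omega>. (?T \<omega>)\<^sup>2) / c\<^sup>2"
    using c by (intro integral_Markov_inequality_measure[where A="{}"] L2_square T) auto
  also have "\<dots> \<le> (\<Sum>k<n. expectation (\<lambda>\<omega>. (X (m + k) \<omega>)\<^sup>2)) / c\<^sup>2"
    by (intro divide_right_mono frozen_sum_second_moment indep X mean) auto
  finally show ?thesis .
qed

text \<open>The maximal inequality bounds the probability that the tail from \<open>m\<close> ever
  reaches level \<open>c\<close> by a tail of the variance series. Hence for every \<open>c\<close>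
  there is almost surely a starting index, depending on the point, whose tail stays below
  \<open>c\<close>; this is the Cauchy property.\<close>

theorem kolmogorov_one_series:
  assumes indep: "indep_vars (\<lambda>_. borel) X UNIV"
    and X: "\<And>k. X k \<in> L2 M" and mean: "\<And>k. expectation (X k) = 0"
    and sm: "summable (\<lambda>k. expectation (\<lambda>\<omega>. (X k \<omega>)\<^sup>2))"
  shows "AE \<omega> in M. summable (\<lambda>k. X k \<omega>)"
proof -
  define V where "V k = expectation (\<lambda>\<omega>. (X k \<omega>)\<^sup>2)" for k
  have V0: "V k \<ge> 0" for k by (simp add: V_def)
  have smV: "summable V" using sm by (simp add: V_def[abs_def])
  have [measurable]: "X k \<in> borel_measurable M" for k using X by (rule L2_measurable)
  have small: "AE \<omega> in M. \<exists>m. \<forall>j. \<bar>\<Sum>k<j. X (m + k) \<omega>\<bar> < c" if c: "c > 0" for c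
  proof -
    define B where "B m n = {\<omega> \<in> space M. \<exists>j\<le>n. c \<le> \<bar>\<Sum>k<j. X (m + k) \<omega>\<bar>}" for m n
    have [measurable]: "B m n \<in> events" for m n by (simp add: B_def)
    have "prob (\<Union>n. B m n) \<le> (\<Sum>k. V (m + k)) / c\<^sup>2" for m
    proof (rule LIMSEQ_le_const2)
      show "(\<lambda>n. prob (B m n)) \<longlonglongrightarrow> prob (\<Union>n. B m n)"
        by (rule finite_Lim_measure_incseq) (auto simp: incseq_def B_def intro: order_trans)
      have "prob (B m n) \<le> (\<Sum>k. V (m + k)) / c\<^sup>2" for n
      proof -
        have "prob (B m n) \<le> (\<Sum>k<n. V (m + k)) / c\<^sup>2"
          unfolding B_def V_def by (rule kolmogorov_maximal[OF indep X mean c])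
        also have "\<dots> \<le> (\<Sum>k. V (m + k)) / c\<^sup>2"
          using summable_ignore_initial_segment[OF smV, of m]
          by (intro divide_right_mono sum_le_suminf) (auto simp: V0 add.commute)
        finally show ?thesis .
      qed
      then show "\<exists>N. \<forall>n\<ge>N. prob (B m n) \<le> (\<Sum>k. V (m + k)) / c\<^sup>2" by auto
    qed
    \<comment> \<open>The bad event says that no starting index \<open>m\<close> works. It lies in
      each of these unions, and their bounds tend to zero with the tails of the variance
      series.\<close>
    moreover have "prob (\<Inter>m. \<Union>n. B m n) \<le> prob (\<Union>n. B m n)" for m
      by (rule finite_measure_mono) auto
    ultimately have le: "prob (\<Inter>m. \<Union>n. B m n) \<le> (\<Sum>k. V (m + k)) / c\<^sup>2" for m
      by (meson order_trans)
    have "(\<lambda>m. (\<Sum>k. V (k + m)) / c\<^sup>2) \<longlonglongrightarrow> 0 / c\<^sup>2"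
      using suminf_exist_split2[OF smV] c by (intro tendsto_divide) auto
    then have "prob (\<Inter>m. \<Union>n. B m n) \<le> 0"
      using le by (intro LIMSEQ_le_const[where X="\<lambda>m. (\<Sum>k. V (k + m)) / c\<^sup>2"]) (auto simp: add.commute)
    then have "(\<Inter>m. \<Union>n. B m n) \<in> null_sets M"
      by (auto simp: null_sets_def emeasure_eq_measure measure_le_0_iff)
    then show ?thesis
      by (rule AE_I') (auto simp: B_def not_less, meson order_refl)
  qed
  have "AE \<omega> in M. \<forall>r::nat. \<exists>m. \<forall>j. \<bar>\<Sum>k<j. X (m + k) \<omega>\<bar> < 1 / Suc r"
    unfolding AE_all_countable by (intro allI small) simp
  then show ?thesis
  proof eventually_elim
    case (elim \<omega>)
    show ?case unfolding summable_Cauchy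
    proof (intro allI impI)
      fix e :: real assume "e > 0"
      \<comment> \<open>Half of \<open>e\<close>, because a segment from \<open>a\<close> to
        \<open>b\<close> is a difference of two segments that start at \<open>m\<close>.\<close>
      then obtain r where r: "1 / Suc r < e / 2" using nat_approx_posE[of "e/2"] by auto
      from elim obtain m where m: "\<And>j. \<bar>\<Sum>k<j. X (m + k) \<omega>\<bar> < 1 / Suc r" by blast
      have seg: "\<bar>sum (\<lambda>k. X k \<omega>) {m..<b}\<bar> < e / 2" for b
      proof -
        have "sum (\<lambda>k. X k \<omega>) {m..<b} = (\<Sum>k<b - m. X (m + k) \<omega>)"
          by (cases "m \<le> b") (auto simp: sum.atLeastLessThan_shift_0 atLeast0LessThan)
        then show ?thesis using m[of "b - m"] r by simp
      qed
      have "\<bar>sum (\<lambda>k. X k \<omega>) {a..<b}\<bar> < e" if "m \<le> a" for a b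
      proof (cases "a \<le> b")
        case True
        then have "sum (\<lambda>k. X k \<omega>) {a..<b} = sum (\<lambda>k. X k \<omega>) {m..<b} - sum (\<lambda>k. X k \<omega>) {m..<a}"
          using that sum.atLeastLessThan_concat[of m a b "\<lambda>k. X k \<omega>"] by simp
        then show ?thesis using seg[of a] seg[of b] by linarith
      next
        case False
        then show ?thesis using \<open>e > 0\<close> by simp
      qed
      then show "\<exists>N. \<forall>m\<ge>N. \<forall>n. norm (sum (\<lambda>k. X k \<omega>) {m..<n}) < e" by auto
    qed
  qed
qed

end

subsection \<open>A mean ergodic theorem for random walk averages\<close>

text \<open>The sum of the absolute values has a finite integral by monotone convergence, so it is
  finite almost everywhere. This takes the role of Borel-Cantelli when almost surely convergent
  subsequences are extracted.\<close>

lemma AE_summable_abs: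
  fixes f :: "nat \<Rightarrow> 'a \<Rightarrow> real"
  assumes f: "\<And>k. integrable M (f k)" and sm: "summable (\<lambda>k. \<integral>\<omega>. \<bar>f k \<omega>\<bar> \<partial>M)"
  shows "AE \<omega> in M. summable (\<lambda>k. \<bar>f k \<omega>\<bar>)"
proof -
  have [measurable]: "f k \<in> borel_measurable M" for k using f by auto
  have "(\<integral>\<^sup>+\<omega>. (\<Sum>k. ennreal \<bar>f k \<omega>\<bar>) \<partial>M) = (\<Sum>k. \<integral>\<^sup>+\<omega>. ennreal \<bar>f k \<omega>\<bar> \<partial>M)"
    by (rule nn_integral_suminf) measurable
  also have "\<dots> = (\<Sum>k. ennreal (\<integral>\<omega>. \<bar>f k \<omega>\<bar> \<partial>M))"
    using f by (intro suminf_cong nn_integral_eq_integral) auto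
  also have "\<dots> = ennreal (\<Sum>k. \<integral>\<omega>. \<bar>f k \<omega>\<bar> \<partial>M)"
    using sm by (intro suminf_ennreal2) auto
  finally have "(\<integral>\<^sup>+\<omega>. (\<Sum>k. ennreal \<bar>f k \<omega>\<bar>) \<partial>M) \<noteq> \<infinity>" by simp
  then have "AE \<omega> in M. (\<Sum>k. ennreal \<bar>f k \<omega>\<bar>) \<noteq> \<infinity>"
    by (intro nn_integral_PInf_AE) measurable
  then show ?thesis
    by eventually_elim (intro summable_suminf_not_top, auto)
qed


text \<open>The rate 1/4 is meant for squared distances: it leaves L1 distances of order
  \<open>(1/2) ^ k\<close>, which are summable. The bound \<open>k \<le> r k\<close> makes
  \<open>r\<close> tend to infinity.\<close>

lemma LIMSEQ_subseq_geometric: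
  fixes e :: "nat \<Rightarrow> real"
  assumes "e \<longlonglongrightarrow> 0"
  obtains r :: "nat \<Rightarrow> nat" where "\<And>k. k \<le> r k" "\<And>k. e (r k) < (1/4) ^ k"
proof -
  have "\<exists>n\<ge>k. e n < (1/4) ^ k" for k
  proof -
    have "eventually (\<lambda>n. e n < (1/4) ^ k) sequentially"
      using assms by (rule order_tendstoD) simp
    then show ?thesis
      using eventually_happens[OF eventually_conj[OF _ eventually_ge_at_top[of k]], of _] by auto
  qed
  then show ?thesis using that by metis
qed

context walk
begin

lemma abs_avg_le:
  assumes "\<And>z. \<bar>f z\<bar> \<le> B"
  shows "\<bar>avg p f x\<bar> \<le> B"
proof -
  have "\<bar>avg p f x\<bar> \<le> (\<Sum>z | p z \<noteq> 0. \<bar>p z * f (x + z)\<bar>)"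
    unfolding avg_def by (rule sum_abs)
  also have "\<dots> \<le> (\<Sum>z | p z \<noteq> 0. p z * B)"
    using assms by (intro sum_mono) (auto simp: abs_mult p_nonneg intro!: mult_left_mono)
  also have "\<dots> = B" by (simp add: sum_distrib_right[symmetric] p_sum)
  finally show ?thesis .
qed

lemma abs_funpow_avg_le: "(\<And>z. \<bar>f z\<bar> \<le> B) \<Longrightarrow> \<bar>(avg p ^^ n) f x\<bar> \<le> B"
  by (induction n arbitrary: x) (auto intro: abs_avg_le)

text \<open>Averaging with probability weights contracts the L1 norm. The bound is uniform in
  \<open>n\<close>, so a truncation error stays small under all iterations.\<close>

lemma integral_abs_funpow_avg_le:
  assumes Y: "\<And>z. integrable M (Y z)" and B: "\<And>z. (\<integral>\<omega>. \<bar>Y z \<omega>\<bar> \<partial>M) \<le> B"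
  shows "(\<integral>\<omega>. \<bar>(avg p ^^ n) (\<lambda>z. Y z \<omega>) x\<bar> \<partial>M) \<le> B"
proof (induction n arbitrary: x)
  case (Suc n)
  let ?X = "\<lambda>x \<omega>. (avg p ^^ n) (\<lambda>z. Y z \<omega>) x"
  have int: "integrable M (?X x)" for x using Y by (rule integrable_funpow_avg)
  have "(\<integral>\<omega>. \<bar>(avg p ^^ Suc n) (\<lambda>z. Y z \<omega>) x\<bar> \<partial>M) \<le> (\<integral>\<omega>. (\<Sum>z | p z \<noteq> 0. p z * \<bar>?X (x + z) \<omega>\<bar>) \<partial>M)"
  proof (intro integral_mono)
    show "integrable M (\<lambda>\<omega>. \<bar>(avg p ^^ Suc n) (\<lambda>z. Y z \<omega>) x\<bar>)"
      by (intro integrable_abs integrable_funpow_avg Y)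
    show "\<bar>(avg p ^^ Suc n) (\<lambda>z. Y z \<omega>) x\<bar> \<le> (\<Sum>z | p z \<noteq> 0. p z * \<bar>?X (x + z) \<omega>\<bar>)" for \<omega>
      unfolding funpow.simps comp_def avg_def[of p "(avg p ^^ n) _"]
      by (rule order_trans[OF sum_abs]) (simp add: abs_mult p_nonneg)
  qed (use int in auto)
  also have "\<dots> = (\<Sum>z | p z \<noteq> 0. p z * (\<integral>\<omega>. \<bar>?X (x + z) \<omega>\<bar> \<partial>M))"
    using int by (simp add: Bochner_Integration.integral_sum)
  also have "\<dots> \<le> (\<Sum>z | p z \<noteq> 0. p z * B)"
    by (intro sum_mono mult_left_mono Suc p_nonneg)
  also have "\<dots> = B" by (simp add: sum_distrib_right[symmetric] p_sum)
  finally show ?case .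
qed (use B in simp)

end

section \<open>Averages along the orbits of a measure preserving action\<close>

locale ergodic_walk = prob_space N + walk p
  for N :: "'a measure" and p :: "'g::{ab_group_add,countable} \<Rightarrow> real" +
  fixes \<theta> :: "'g \<Rightarrow> 'a \<Rightarrow> 'a"
  assumes act_measurable [measurable]: "\<theta> a \<in> measurable N N"
    and act_add: "\<theta> (a + b) \<omega> = \<theta> a (\<theta> b \<omega>)"
    and act_distr: "distr N N (\<theta> a) = N"
    and act_ergodic: "A \<in> events \<Longrightarrow> (\<And>a \<omega>. \<omega> \<in> space N \<Longrightarrow> \<theta> a \<omega> \<in> A \<longleftrightarrow> \<omega> \<in> A) \<Longrightarrow> prob A = 0 \<or> prob A = 1"
    and generates: "\<And>u. subgroup_gen {u + x | x. 0 < p x} = UNIV"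
begin

text \<open>The field that is averaged is the observable \<open>f\<close> read along the orbit of
  \<omega>. For the shift and a coordinate observable these are the averages of the configuration
  itself.\<close>

definition walk_avg :: "('a \<Rightarrow> real) \<Rightarrow> nat \<Rightarrow> 'g \<Rightarrow> 'a \<Rightarrow> real" where
  "walk_avg f k x \<omega> = (avg p ^^ k) (\<lambda>z. f (\<theta> z \<omega>)) x"

lemma integral_act:
  fixes h :: "'a \<Rightarrow> real"
  assumes "h \<in> borel_measurable N"
  shows "(\<integral>\<omega>. h (\<theta> a \<omega>) \<partial>N) = (\<integral>\<omega>. h \<omega> \<partial>N)"
  using integral_distr[of "\<theta> a" N N h] assms by (simp add: act_distr)

lemma integrable_act:
  fixes h :: "'a \<Rightarrow> real"
  assumes "integrable N h"
  shows "integrable N (\<lambda>\<omega>. h (\<theta> a \<omega>))"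
  using integrable_distr[of "\<theta> a" N N h] assms by (simp add: act_distr)

text \<open>Iterated averages commute with translations. Invariance of a limit under the action will
  therefore follow from vanishing spatial increments.\<close>

lemma walk_avg_act: "walk_avg f k x (\<theta> a \<omega>) = walk_avg f k (x + a) \<omega>"
  unfolding walk_avg_def act_add[symmetric] by (rule funpow_avg_translate)

lemma walk_avg_0: "walk_avg f 0 x \<omega> = f (\<theta> x \<omega>)"
  by (simp add: walk_avg_def)

lemma walk_avg_Suc: "walk_avg f (Suc k) x \<omega> = avg p (\<lambda>z. walk_avg f k z \<omega>) x"
  by (simp add: walk_avg_def)

lemma walk_avg_measurable [measurable]: "f \<in> borel_measurable N \<Longrightarrow> walk_avg f k x \<in> borel_measurable N"
  unfolding walk_avg_def[abs_def] by (intro borel_measurable_funpow_avg measurable_compose[OF act_measurable])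

lemma walk_avg_integrable: "integrable N f \<Longrightarrow> integrable N (walk_avg f k x)"
  unfolding walk_avg_def[abs_def] by (intro integrable_funpow_avg integrable_act)

lemma walk_avg_mean:
  assumes "integrable N f"
  shows "(\<integral>\<omega>. walk_avg f k x \<omega> \<partial>N) = (\<integral>\<omega>. f \<omega> \<partial>N)"
proof (induction k arbitrary: x)
  case 0
  then show ?case using integral_act[of f x] assms by (simp add: walk_avg_0)
next
  case (Suc k)
  have "(\<integral>\<omega>. walk_avg f (Suc k) x \<omega> \<partial>N) = (\<Sum>z | p z \<noteq> 0. p z * (\<integral>\<omega>. walk_avg f k (x + z) \<omega> \<partial>N))"
    unfolding walk_avg_Suc avg_def by (simp add: walk_avg_integrable assms Bochner_Integration.integral_sum)
  then show ?case by (simp add: Suc sum_distrib_right[symmetric] p_sum)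
qed

lemma bounded_L2:
  assumes "g \<in> borel_measurable N" "\<And>\<omega>. \<bar>g \<omega>\<bar> \<le> B"
  shows "g \<in> L2 N"
proof -
  have "(\<lambda>_. B) \<in> L2 N" by (simp add: L2_def)
  then show ?thesis by (rule L2_mono) (use assms in \<open>auto intro: order_trans[OF _ abs_ge_self]\<close>)
qed

lemma wide_stationary_act:
  assumes [measurable]: "g \<in> borel_measurable N" and "\<And>\<omega>. \<bar>g \<omega>\<bar> \<le> B"
  shows "wide_stationary N (\<lambda>x \<omega>. g (\<theta> x \<omega>))"
proof -
  have "(\<integral>\<omega>. g (\<theta> (x + a) \<omega>) * g (\<theta> (y + a) \<omega>) \<partial>N) = (\<integral>\<omega>. g (\<theta> x \<omega>) * g (\<theta> y \<omega>) \<partial>N)" for x y a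
    unfolding act_add by (rule integral_act[of "\<lambda>\<omega>. g (\<theta> x \<omega>) * g (\<theta> y \<omega>)"]) measurable
  moreover have "(\<lambda>\<omega>. g (\<theta> x \<omega>)) \<in> L2 N" for x
    using assms(2) by (intro bounded_L2) auto
  ultimately show ?thesis by (simp add: wide_stationary_def)
qed

text \<open>The loss in \<open>energy_identity\<close> is a sum of non-negative terms.\<close>

lemma energy_decreasing:
  assumes Y: "wide_stationary N Y"
  shows "decseq (\<lambda>k. \<integral>\<omega>. (avg p ^^ k) (\<lambda>z. Y z \<omega>) 0 * (avg p ^^ k) (\<lambda>z. Y z \<omega>) 0 \<partial>N)"
proof (rule decseq_SucI)
  fix k
  have "(\<Sum>z | p z \<noteq> 0. \<Sum>w | p w \<noteq> 0. p z * p w *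
      (\<integral>\<omega>. ((avg p ^^ k) (\<lambda>z. Y z \<omega>) z - (avg p ^^ k) (\<lambda>z. Y z \<omega>) w)\<^sup>2 \<partial>N)) \<ge> 0"
    by (intro sum_nonneg mult_nonneg_nonneg p_nonneg Bochner_Integration.integral_nonneg) auto
  then show "(\<integral>\<omega>. (avg p ^^ Suc k) (\<lambda>z. Y z \<omega>) 0 * (avg p ^^ Suc k) (\<lambda>z. Y z \<omega>) 0 \<partial>N)
     \<le> (\<integral>\<omega>. (avg p ^^ k) (\<lambda>z. Y z \<omega>) 0 * (avg p ^^ k) (\<lambda>z. Y z \<omega>) 0 \<partial>N)"
    using energy_identity[OF wide_stationary_funpow_avg[OF Y], of k] by simp
qed

text \<open>The decreasing energies have a limit \<open>K\<close>, and the task is to show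
  \<open>K = 0\<close>. Averages along a fast subsequence converge almost surely to some
  \<open>h\<close>; vanishing increments make \<open>h\<close> invariant, ergodicity and the zero
  mean make it vanish, and bounded convergence gives \<open>K = 0\<close>.\<close>

lemma mean_ergodic_bounded:
  assumes [measurable]: "f \<in> borel_measurable N" and B: "\<And>\<omega>. \<bar>f \<omega>\<bar> \<le> B"
    and mean: "(\<integral>\<omega>. f \<omega> \<partial>N) = 0"
  shows "(\<lambda>k. \<integral>\<omega>. (walk_avg f k 0 \<omega>)\<^sup>2 \<partial>N) \<longlonglongrightarrow> 0"
proof -
  have int_f: "integrable N f"
    using B by (intro integrable_const_bound[of _ B]) auto
  have XB: "\<bar>walk_avg f k x \<omega>\<bar> \<le> B" for k x \<omega>
    unfolding walk_avg_def by (rule abs_funpow_avg_le) (rule B)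
  have L: "walk_avg f k x \<in> L2 N" for k x
    by (rule bounded_L2[OF _ XB]) measurable
  define E where "E k = (\<integral>\<omega>. walk_avg f k 0 \<omega> * walk_avg f k 0 \<omega> \<partial>N)" for k
  have WS0: "wide_stationary N (\<lambda>x \<omega>. f (\<theta> x \<omega>))"
    by (rule wide_stationary_act[OF _ B]) measurable
  have WS: "wide_stationary N (walk_avg f k)" for k
    using wide_stationary_funpow_avg[OF WS0] unfolding walk_avg_def .
  have "decseq E" unfolding E_def walk_avg_def by (rule energy_decreasing[OF WS0])
  moreover have "E k \<ge> 0" for k by (simp add: E_def)
  ultimately obtain K where K: "E \<longlonglongrightarrow> K" "\<And>k. K \<le> E k"
    using decseq_convergent[of E 0] by auto

  define V where "V k z = (\<integral>\<omega>. (walk_avg f k z \<omega> - walk_avg f k 0 \<omega>)\<^sup>2 \<partial>N)" for k z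
  have V_sum: "summable (\<lambda>k. V k z)" for z
    using summable_square_increment[OF WS0 generates, of z 0] by (simp add: V_def walk_avg_def)
  \<comment> \<open>Polarisation expresses the cross moment of successive averages by
    \<open>E k\<close> and the increments \<open>V k z\<close>. Both the energy differences and the
    increments tend to zero.\<close>
  have step0: "(\<lambda>k. \<integral>\<omega>. (walk_avg f (Suc k) 0 \<omega> - walk_avg f k 0 \<omega>)\<^sup>2 \<partial>N) \<longlonglongrightarrow> 0"
  proof -
    have cross: "(\<integral>\<omega>. walk_avg f k z \<omega> * walk_avg f k 0 \<omega> \<partial>N) = E k - V k z / 2" for k z
      using integral_square_diff[OF L L, of k z k 0] wide_stationary_square[OF WS, of k z]
      by (simp add: V_def E_def field_simps)
    have "(\<integral>\<omega>. walk_avg f (Suc k) 0 \<omega> * walk_avg f k 0 \<omega> \<partial>N) = E k - (\<Sum>z | p z \<noteq> 0. p z * V k z) / 2" for k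
    proof -
      have "(\<integral>\<omega>. walk_avg f (Suc k) 0 \<omega> * walk_avg f k 0 \<omega> \<partial>N)
          = (\<integral>\<omega>. (\<Sum>z | p z \<noteq> 0. p z * (walk_avg f k z \<omega> * walk_avg f k 0 \<omega>)) \<partial>N)"
        unfolding walk_avg_Suc avg_def by (simp add: sum_distrib_right mult.assoc)
      also have "\<dots> = (\<Sum>z | p z \<noteq> 0. p z * (E k - V k z / 2))"
        using L2_mult[OF L L] by (simp add: Bochner_Integration.integral_sum cross)
      also have "\<dots> = E k - (\<Sum>z | p z \<noteq> 0. p z * V k z) / 2"
        by (simp add: right_diff_distrib sum_subtractf sum_divide_distrib sum_distrib_right[symmetric] p_sum)
      finally show ?thesis .
    qed
    then have eq: "(\<integral>\<omega>. (walk_avg f (Suc k) 0 \<omega> - walk_avg f k 0 \<omega>)\<^sup>2 \<partial>N) = E (Suc k) - E k + (\<Sum>z | p z \<noteq> 0. p z * V k z)" for k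
      using integral_square_diff[OF L L, of "Suc k" 0 k 0] by (simp add: E_def)
    have "(\<lambda>k. E (Suc k) - E k + (\<Sum>z | p z \<noteq> 0. p z * V k z)) \<longlonglongrightarrow> K - K + (\<Sum>z | p z \<noteq> 0. p z * 0)"
      by (intro tendsto_intros K(1) LIMSEQ_Suc summable_LIMSEQ_zero V_sum)
    then show ?thesis by (simp add: eq)
  qed
  define D where "D s t = (\<integral>\<omega>. (walk_avg f s 0 \<omega> - walk_avg f t 0 \<omega>)\<^sup>2 \<partial>N)" for s t
  have sq_int: "integrable N (\<lambda>\<omega>. (walk_avg f s 0 \<omega> - walk_avg f t 0 \<omega>)\<^sup>2)" for s t
    by (intro L2_square L2_diff L)
  have D_tri: "D s t \<le> 2 * D s r + 2 * D r t" for s r t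
  proof -
    have "D s t \<le> (\<integral>\<omega>. 2 * (walk_avg f s 0 \<omega> - walk_avg f r 0 \<omega>)\<^sup>2 + 2 * (walk_avg f r 0 \<omega> - walk_avg f t 0 \<omega>)\<^sup>2 \<partial>N)"
      unfolding D_def
    proof (intro integral_mono)
      have "(a - c)\<^sup>2 \<le> 2 * (a - b)\<^sup>2 + 2 * (b - c)\<^sup>2" for a b c :: real
        using zero_le_power2[of "(a - b) - (b - c)"] by (simp add: power2_eq_square algebra_simps)
      then show "(walk_avg f s 0 \<omega> - walk_avg f t 0 \<omega>)\<^sup>2 \<le> 2 * (walk_avg f s 0 \<omega> - walk_avg f r 0 \<omega>)\<^sup>2 + 2 * (walk_avg f r 0 \<omega> - walk_avg f t 0 \<omega>)\<^sup>2" for \<omega> .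
    qed (use sq_int in auto)
    then show ?thesis using sq_int by (simp add: D_def)
  qed
  \<comment> \<open>This chains \<open>d\<close> single steps. The lag is fixed, so it is not yet
    the Cauchy property, which comes from \<open>D_le\<close>.\<close>
  have D_lim: "(\<lambda>n. D (n + d) n) \<longlonglongrightarrow> 0" for d
  proof (induction d)
    case (Suc d)
    have "(\<lambda>n. 2 * D (Suc (n + d)) (n + d) + 2 * D (n + d) n) \<longlonglongrightarrow> 2 * 0 + 2 * 0"
      using step0 unfolding D_def[symmetric]
      by (intro tendsto_intros Suc LIMSEQ_ignore_initial_segment[of "\<lambda>n. D (Suc n) n" 0 d])
    then have lim: "(\<lambda>n. 2 * D (Suc (n + d)) (n + d) + 2 * D (n + d) n) \<longlonglongrightarrow> 0" by simp
    show ?case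
    proof (rule tendsto_sandwich[OF _ _ tendsto_const lim])
      show "\<forall>\<^sub>F n in sequentially. D (n + Suc d) n \<le> 2 * D (Suc (n + d)) (n + d) + 2 * D (n + d) n"
        using D_tri[of "Suc (n + d)" n "n + d" for n] by simp
    qed (simp add: D_def)
  qed (simp add: D_def)

  \<comment> \<open>The sum \<open>w\<close> of the averages at times \<open>s\<close> and
    \<open>t\<close> is again an observable. Its energy decreases under further averaging to
    \<open>4 * K\<close>, since the lag between the two summands stays fixed. The parallelogram law
    at n = 0 then bounds \<open>D s t\<close> uniformly in the lag.\<close>
  have D_le: "D s t \<le> 2 * (E s - K) + 2 * (E t - K)" if "t \<le> s" for s t
  proof -
    define w where "w \<omega> = walk_avg f s 0 \<omega> + walk_avg f t 0 \<omega>" for \<omega>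
    have [measurable]: "w \<in> borel_measurable N" unfolding w_def by measurable
    have wB: "\<bar>w \<omega>\<bar> \<le> 2 * B" for \<omega>
      using XB[of s 0 \<omega>] XB[of t 0 \<omega>] unfolding w_def by linarith
    have par: "(\<integral>\<omega>. (walk_avg f a 0 \<omega> + walk_avg f b 0 \<omega>) * (walk_avg f a 0 \<omega> + walk_avg f b 0 \<omega>) \<partial>N) = 2 * E a + 2 * E b - D a b" for a b
    proof -
      have "(\<integral>\<omega>. (walk_avg f a 0 \<omega> + walk_avg f b 0 \<omega>) * (walk_avg f a 0 \<omega> + walk_avg f b 0 \<omega>) \<partial>N)
        = (\<integral>\<omega>. 2 * (walk_avg f a 0 \<omega> * walk_avg f a 0 \<omega>) + 2 * (walk_avg f b 0 \<omega> * walk_avg f b 0 \<omega>) - (walk_avg f a 0 \<omega> - walk_avg f b 0 \<omega>)\<^sup>2 \<partial>N)"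
        by (simp add: power2_eq_square algebra_simps)
      also have "\<dots> = 2 * E a + 2 * E b - D a b"
        using sq_int L2_mult[OF L L] by (simp add: E_def D_def)
      finally show ?thesis .
    qed
    have Xw: "walk_avg w n 0 \<omega> = walk_avg f (n + s) 0 \<omega> + walk_avg f (n + t) 0 \<omega>" for n \<omega>
    proof -
      have *: "(\<lambda>z. walk_avg f k 0 (\<theta> z \<omega>)) = (avg p ^^ k) (\<lambda>z. f (\<theta> z \<omega>))" for k
        by (auto simp: walk_avg_act) (simp add: walk_avg_def)
      have "walk_avg w n 0 \<omega> = (avg p ^^ n) (\<lambda>z. walk_avg f s 0 (\<theta> z \<omega>)) 0 + (avg p ^^ n) (\<lambda>z. walk_avg f t 0 (\<theta> z \<omega>)) 0"
        unfolding funpow_avg_add[symmetric] by (simp add: walk_avg_def[of w] w_def)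
      also have "\<dots> = walk_avg f (n + s) 0 \<omega> + walk_avg f (n + t) 0 \<omega>"
        unfolding * by (simp add: walk_avg_def funpow_add)
      finally show ?thesis .
    qed
    have dec: "decseq (\<lambda>n. \<integral>\<omega>. walk_avg w n 0 \<omega> * walk_avg w n 0 \<omega> \<partial>N)"
      unfolding walk_avg_def by (rule energy_decreasing[OF wide_stationary_act[OF _ wB]]) measurable
    have "(\<lambda>n. 2 * E (n + s) + 2 * E (n + t) - D (n + s) (n + t)) \<longlonglongrightarrow> 2 * K + 2 * K - 0"
    proof (intro tendsto_intros LIMSEQ_ignore_initial_segment K(1))
      have "(\<lambda>n. D (n + t + (s - t)) (n + t)) \<longlonglongrightarrow> 0"
        using LIMSEQ_ignore_initial_segment[OF D_lim, of t] .
      then show "(\<lambda>n. D (n + s) (n + t)) \<longlonglongrightarrow> 0" using that by simp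
    qed
    then have "(\<lambda>n. \<integral>\<omega>. walk_avg w n 0 \<omega> * walk_avg w n 0 \<omega> \<partial>N) \<longlonglongrightarrow> 4 * K"
      by (simp add: Xw par)
    from decseq_ge[OF dec this, of 0] have "4 * K \<le> 2 * E s + 2 * E t - D s t"
      by (simp add: Xw par)
    then show ?thesis by simp
  qed
  have D_sym: "D s t = D t s" for s t by (simp add: D_def power2_commute)
  have D_le': "D s t \<le> 2 * (E s - K) + 2 * (E t - K)" for s t
    using D_le[of s t] D_le[of t s] D_sym[of s t] by (cases "s \<le> t") auto

  have "(\<lambda>k. E k - K) \<longlonglongrightarrow> 0" using K(1) by (simp add: LIM_zero)
  then obtain r where r: "\<And>k. k \<le> r k" "\<And>k. E (r k) - K < (1/4) ^ k"
    using LIMSEQ_subseq_geometric by blast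
  have r_top: "filterlim r at_top sequentially"
    using r(1) by (intro filterlim_at_top_mono[OF filterlim_ident]) auto
  define d where "d k \<omega> = walk_avg f (r (Suc k)) 0 \<omega> - walk_avg f (r k) 0 \<omega>" for k \<omega>
  have d_int: "integrable N (d k)" for k
    unfolding d_def by (intro Bochner_Integration.integrable_diff walk_avg_integrable int_f)
  \<comment> \<open>Arithmetic-geometric mean inequality with weight \<open>2^k\<close>, tuned to
    squared distances of order \<open>(1/4)^k\<close>. The constant is 1 + 4: one from the first
    term, four from the bound on \<open>D (r (Suc k)) (r k)\<close>.\<close>
  have d_le: "(\<integral>\<omega>. \<bar>d k \<omega>\<bar> \<partial>N) \<le> 5 * (1/2) ^ k" for k
  proof -
    have "(\<integral>\<omega>. \<bar>d k \<omega>\<bar> \<partial>N) \<le> (\<integral>\<omega>. (1/2)^k + 2^k * (walk_avg f (r (Suc k)) 0 \<omega> - walk_avg f (r k) 0 \<omega>)\<^sup>2 \<partial>N)"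
    proof (intro integral_mono)
      have "\<bar>x\<bar> \<le> (1/2)^k + 2^k * x\<^sup>2" for x :: real
      proof -
        have "0 \<le> 2^k * ((1/2)^k - \<bar>x\<bar>)\<^sup>2" by simp
        also have "\<dots> = (1/2)^k - 2 * \<bar>x\<bar> + 2^k * x\<^sup>2"
          by (simp add: power2_eq_square algebra_simps power_one_over)
        finally show ?thesis by simp
      qed
      then show "\<bar>d k \<omega>\<bar> \<le> (1/2)^k + 2^k * (walk_avg f (r (Suc k)) 0 \<omega> - walk_avg f (r k) 0 \<omega>)\<^sup>2" for \<omega>
        unfolding d_def .
    qed (use d_int sq_int in auto)
    also have "\<dots> = (1/2)^k + 2^k * D (r (Suc k)) (r k)"
      using sq_int by (simp add: D_def prob_space)
    also have "D (r (Suc k)) (r k) \<le> 4 * (1/4)^k"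
    proof -
      define q :: real where "q = (1/4)^k"
      have "0 \<le> q" "E (r (Suc k)) - K < q / 4" "E (r k) - K < q"
        using r(2)[of k] r(2)[of "Suc k"] by (simp_all add: q_def)
      moreover have "D' \<le> 4 * q" if "D' \<le> 2 * (a - K) + 2 * (b - K)" "0 \<le> q" "a - K < q / 4" "b - K < q" for D' a b :: real
        using that by argo
      ultimately show ?thesis
        using D_le'[of "r (Suc k)" "r k"] unfolding q_def[symmetric] by blast
    qed
    finally have "(\<integral>\<omega>. \<bar>d k \<omega>\<bar> \<partial>N) \<le> (1/2)^k + 2^k * (4 * (1/4)^k)" by simp
    also have "(2::real)^k * (4 * (1/4)^k) = 4 * (2 * (1/4))^k" unfolding power_mult_distrib by simp
    finally show ?thesis by simp
  qed
  have "AE \<omega> in N. summable (\<lambda>k. \<bar>d k \<omega>\<bar>)"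
  proof (rule AE_summable_abs[OF d_int])
    have "summable (\<lambda>k. 5 * (1/2::real)^k)" by (intro summable_mult summable_geometric) simp
    then show "summable (\<lambda>k. \<integral>\<omega>. \<bar>d k \<omega>\<bar> \<partial>N)"
      by (rule summable_comparison_test'[where N=0]) (use d_le in auto)
  qed
  then have conv: "AE \<omega> in N. convergent (\<lambda>k. walk_avg f (r k) 0 \<omega>)"
  proof eventually_elim
    case (elim \<omega>)
    have "(\<Sum>k<n. d k \<omega>) = walk_avg f (r n) 0 \<omega> - walk_avg f (r 0) 0 \<omega>" for n
      unfolding d_def by (rule sum_lessThan_telescope)
    moreover have "(\<lambda>n. \<Sum>k<n. d k \<omega>) \<longlonglongrightarrow> (\<Sum>k. d k \<omega>)"
      using summable_rabs_cancel[OF elim] by (rule summable_LIMSEQ)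
    ultimately have "(\<lambda>n. walk_avg f (r n) 0 \<omega> - walk_avg f (r 0) 0 \<omega> + walk_avg f (r 0) 0 \<omega>) \<longlonglongrightarrow> (\<Sum>k. d k \<omega>) + walk_avg f (r 0) 0 \<omega>"
      by (intro tendsto_add) auto
    then show ?case by (auto simp: convergent_def)
  qed
  \<comment> \<open>\<open>lim\<close> takes an unspecified value where the sequence diverges. This
    happens only on a null set, and \<open>h\<close> is measurable on the whole space.\<close>
  define h where "h \<omega> = lim (\<lambda>k. walk_avg f (r k) 0 \<omega>)" for \<omega>
  have [measurable]: "h \<in> borel_measurable N" unfolding h_def by measurable
  have lim_h: "AE \<omega> in N. (\<lambda>k. walk_avg f (r k) 0 \<omega>) \<longlonglongrightarrow> h \<omega>"
    using conv by eventually_elim (simp add: h_def convergent_LIMSEQ_iff)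
  \<comment> \<open>Square summability in \<open>k\<close>, for all of the countably many
    \<open>z\<close> at once, forces the increments to zero along the whole sequence. The averages
    started at \<open>z\<close> and at 0 then share their limit.\<close>
  have "AE \<omega> in N. summable (\<lambda>k. \<bar>(walk_avg f k z \<omega> - walk_avg f k 0 \<omega>)\<^sup>2\<bar>)" for z
    by (rule AE_summable_abs) (use V_sum[of z] in \<open>auto simp: V_def intro!: L2_square L2_diff L\<close>)
  then have "AE \<omega> in N. \<forall>z. summable (\<lambda>k. (walk_avg f k z \<omega> - walk_avg f k 0 \<omega>)\<^sup>2)"
    unfolding AE_all_countable by simp
  then have inv: "AE \<omega> in N. \<forall>z. h (\<theta> z \<omega>) = h \<omega>"
    using lim_h
  proof eventually_elim
    case (elim \<omega>)
    show ?case
    proof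
      fix z
      have "(\<lambda>k. (walk_avg f k z \<omega> - walk_avg f k 0 \<omega>)\<^sup>2) \<longlonglongrightarrow> 0" using elim by (intro summable_LIMSEQ_zero) auto
      then have "(\<lambda>k. walk_avg f k z \<omega> - walk_avg f k 0 \<omega>) \<longlonglongrightarrow> 0" using tendsto_real_sqrt[of _ 0] by (force simp: tendsto_rabs_zero_iff)
      then have "(\<lambda>k. walk_avg f (r k) z \<omega> - walk_avg f (r k) 0 \<omega>) \<longlonglongrightarrow> 0"
        using r_top by (rule filterlim_compose)
      from tendsto_add[OF this elim(2)] have "(\<lambda>k. walk_avg f (r k) z \<omega>) \<longlonglongrightarrow> h \<omega>" by simp
      then show "h (\<theta> z \<omega>) = h \<omega>" unfolding h_def[of "\<theta> z \<omega>"] walk_avg_act by (simp add: limI)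
    qed
  qed
  have h_int: "integrable N h" and h_mean: "(\<integral>\<omega>. h \<omega> \<partial>N) = 0"
  proof -
    have bound: "AE \<omega> in N. norm (walk_avg f (r k) 0 \<omega>) \<le> B" for k using XB by simp
    have lim: "(\<lambda>k. \<integral>\<omega>. walk_avg f (r k) 0 \<omega> \<partial>N) \<longlonglongrightarrow> (\<integral>\<omega>. h \<omega> \<partial>N)"
      by (rule integral_dominated_convergence[OF _ _ _ lim_h bound]) auto
    show "integrable N h"
      by (rule integrable_dominated_convergence[OF _ _ _ lim_h bound]) auto
    from lim show "(\<integral>\<omega>. h \<omega> \<partial>N) = 0"
      by (simp add: walk_avg_mean[OF int_f] mean LIMSEQ_const_iff)
  qed
  \<comment> \<open>\<open>h\<close> is known to be invariant only almost surely. Asking for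
    positivity along the whole orbit gives an exactly invariant event, equal to the event
    \<open>0 < h \<omega>\<close> up to a null set.\<close>
  define A where "A = {\<omega> \<in> space N. \<forall>a. 0 < h (\<theta> a \<omega>)}"
  have A: "A \<in> events" unfolding A_def by measurable
  have "\<theta> a \<omega> \<in> A \<longleftrightarrow> \<omega> \<in> A" if "\<omega> \<in> space N" for a \<omega>
  proof -
    have "(\<forall>b. 0 < h (\<theta> (b + a) \<omega>)) \<longleftrightarrow> (\<forall>b. 0 < h (\<theta> b \<omega>))"
      by (metis diff_add_cancel)
    then show ?thesis
      using that measurable_space[OF act_measurable, of \<omega> a] by (simp add: A_def act_add)
  qed
  then have "prob A = 0 \<or> prob A = 1" by (rule act_ergodic[OF A])
  then have "(AE \<omega> in N. \<omega> \<notin> A) \<or> (AE \<omega> in N. \<omega> \<in> A)"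
    using A by (auto simp: prob_eq_0 prob_eq_1)
  note A_01 = this
  have AE_A: "AE \<omega> in N. \<omega> \<in> A \<longleftrightarrow> 0 < h \<omega>"
    using inv AE_space by eventually_elim (auto simp: A_def)
  \<comment> \<open>In either case \<open>h\<close> has a constant sign almost surely, so its zero
    mean forces it to vanish.\<close>
  from A_01 have h0: "AE \<omega> in N. h \<omega> = 0"
  proof
    assume "AE \<omega> in N. \<omega> \<notin> A"
    with AE_A have "AE \<omega> in N. 0 \<le> - h \<omega>" by eventually_elim auto
    then show ?thesis
      using integral_nonneg_eq_0_iff_AE[of N "\<lambda>\<omega>. - h \<omega>"] h_int h_mean by auto
  next
    assume "AE \<omega> in N. \<omega> \<in> A"
    with AE_A have "AE \<omega> in N. 0 \<le> h \<omega>" by eventually_elim auto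
    then show ?thesis
      using integral_nonneg_eq_0_iff_AE[of N h] h_int h_mean by auto
  qed
  have "(\<lambda>k. \<integral>\<omega>. walk_avg f (r k) 0 \<omega> * walk_avg f (r k) 0 \<omega> \<partial>N) \<longlonglongrightarrow> (\<integral>\<omega>. 0 \<partial>N)"
  proof (rule integral_dominated_convergence)
    show "AE \<omega> in N. (\<lambda>k. walk_avg f (r k) 0 \<omega> * walk_avg f (r k) 0 \<omega>) \<longlonglongrightarrow> 0"
      using lim_h h0 by eventually_elim (auto intro: tendsto_mult_zero)
    show "AE \<omega> in N. norm (walk_avg f (r k) 0 \<omega> * walk_avg f (r k) 0 \<omega>) \<le> B * B" for k
      unfolding real_norm_def abs_mult
      by (intro AE_I2 mult_mono XB) (auto intro: order_trans[OF abs_ge_zero XB])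
  qed auto
  moreover have "(\<lambda>k. E (r k)) \<longlonglongrightarrow> K" using K(1) r_top by (rule filterlim_compose)
  ultimately have "K = 0" unfolding E_def by (simp add: LIMSEQ_unique)
  then show ?thesis using K(1) by (simp add: E_def[abs_def] power2_eq_square)
qed


text \<open>Truncation reduces this to the bounded case. The L1 contraction carries the truncation
  error with a bound independent of \<open>k\<close>, and invariance of the measure moves the result
  from site 0 to \<open>x\<close>.\<close>

lemma mean_ergodic_L1:
  assumes f: "integrable N f" and mean: "(\<integral>\<omega>. f \<omega> \<partial>N) = 0"
  shows "(\<lambda>k. \<integral>\<omega>. \<bar>walk_avg f k x \<omega>\<bar> \<partial>N) \<longlonglongrightarrow> 0"
proof -
  have [measurable]: "f \<in> borel_measurable N" using f by auto
  have "(\<lambda>k. \<integral>\<omega>. \<bar>walk_avg f k 0 \<omega>\<bar> \<partial>N) \<longlonglongrightarrow> 0"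
  proof (rule LIMSEQ_I)
    fix e :: real assume e: "e > 0"
    define tr where "tr n \<omega> = max (- real n) (min (real n) (f \<omega>))" for n \<omega>
    have tr_le: "\<bar>tr n \<omega>\<bar> \<le> real n" for n \<omega> by (auto simp: tr_def)
    have [measurable]: "tr n \<in> borel_measurable N" for n unfolding tr_def by measurable
    have tr_int: "integrable N (tr n)" for n
      using tr_le by (intro integrable_const_bound[of _ "real n"]) auto
    have "(\<lambda>n. \<integral>\<omega>. \<bar>f \<omega> - tr n \<omega>\<bar> \<partial>N) \<longlonglongrightarrow> (\<integral>\<omega>. 0 \<partial>N)"
    proof (rule integral_dominated_convergence[where w="\<lambda>\<omega>. \<bar>f \<omega>\<bar>"])
      show "AE \<omega> in N. (\<lambda>n. \<bar>f \<omega> - tr n \<omega>\<bar>) \<longlonglongrightarrow> 0"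
      proof (rule AE_I2, rule tendsto_eventually)
        fix \<omega>
        show "\<forall>\<^sub>F n in sequentially. \<bar>f \<omega> - tr n \<omega>\<bar> = 0"
          using eventually_ge_at_top[of "nat \<lceil>\<bar>f \<omega>\<bar>\<rceil>"]
          by eventually_elim (auto simp: tr_def nat_le_iff ceiling_le_iff)
      qed
      show "AE \<omega> in N. norm \<bar>f \<omega> - tr n \<omega>\<bar> \<le> \<bar>f \<omega>\<bar>" for n
        by (auto simp: tr_def)
    qed (use f in auto)
    then have "\<forall>\<^sub>F n in sequentially. (\<integral>\<omega>. \<bar>f \<omega> - tr n \<omega>\<bar> \<partial>N) < e / 4"
      using e by (intro order_tendstoD) auto
    then obtain n where n: "(\<integral>\<omega>. \<bar>f \<omega> - tr n \<omega>\<bar> \<partial>N) < e / 4"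
      by (auto simp: eventually_sequentially)
    \<comment> \<open>Recentring the truncation: since \<open>f\<close> has mean zero,
      \<open>\<bar>m\<bar>\<close> is at most the truncation error, so replacing \<open>f\<close> by
      \<open>g\<close> costs at most twice e / 4.\<close>
    define m where "m = (\<integral>\<omega>. tr n \<omega> \<partial>N)"
    define g where "g \<omega> = tr n \<omega> - m" for \<omega>
    have [measurable]: "g \<in> borel_measurable N" unfolding g_def by measurable
    have g_int: "integrable N g" unfolding g_def using tr_int by auto
    have fg_int: "integrable N (\<lambda>\<omega>. f \<omega> - g \<omega>)" using f g_int by auto
    have "\<bar>m\<bar> = \<bar>\<integral>\<omega>. f \<omega> - tr n \<omega> \<partial>N\<bar>" using f tr_int mean by (simp add: m_def)
    also have "\<dots> \<le> (\<integral>\<omega>. \<bar>f \<omega> - tr n \<omega>\<bar> \<partial>N)" by (rule integral_abs_bound)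
    finally have m: "\<bar>m\<bar> < e / 4" using n by simp
    have "(\<integral>\<omega>. \<bar>f \<omega> - g \<omega>\<bar> \<partial>N) \<le> (\<integral>\<omega>. \<bar>f \<omega> - tr n \<omega>\<bar> + \<bar>m\<bar> \<partial>N)"
      using fg_int f tr_int by (intro integral_mono) (auto simp: g_def)
    also have "\<dots> = (\<integral>\<omega>. \<bar>f \<omega> - tr n \<omega>\<bar> \<partial>N) + \<bar>m\<bar>"
      using f tr_int by (simp add: prob_space)
    also have "\<dots> \<le> e / 2" using m n by simp
    finally have fg: "(\<integral>\<omega>. \<bar>f \<omega> - g \<omega>\<bar> \<partial>N) \<le> e / 2" .
    have rest: "(\<integral>\<omega>. \<bar>walk_avg (\<lambda>\<omega>. f \<omega> - g \<omega>) k 0 \<omega>\<bar> \<partial>N) \<le> e / 2" for k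
      unfolding walk_avg_def
      by (rule integral_abs_funpow_avg_le[OF integrable_act[OF fg_int]])
         (use fg integral_act[of "\<lambda>\<omega>. \<bar>f \<omega> - g \<omega>\<bar>"] in simp)
    have "(\<lambda>k. \<integral>\<omega>. (walk_avg g k 0 \<omega>)\<^sup>2 \<partial>N) \<longlonglongrightarrow> 0"
    proof (rule mean_ergodic_bounded)
      show "\<bar>g \<omega>\<bar> \<le> real n + \<bar>m\<bar>" for \<omega> using tr_le[of n \<omega>] by (simp add: g_def)
      show "(\<integral>\<omega>. g \<omega> \<partial>N) = 0" using tr_int by (simp add: g_def m_def prob_space)
    qed measurable
    then have "\<forall>\<^sub>F k in sequentially. (\<integral>\<omega>. (walk_avg g k 0 \<omega>)\<^sup>2 \<partial>N) < (e / 4)\<^sup>2"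
      using e by (intro order_tendstoD) auto
    then obtain k0 where k0: "\<And>k. k \<ge> k0 \<Longrightarrow> (\<integral>\<omega>. (walk_avg g k 0 \<omega>)\<^sup>2 \<partial>N) < (e / 4)\<^sup>2"
      by (auto simp: eventually_sequentially)
    have "norm ((\<integral>\<omega>. \<bar>walk_avg f k 0 \<omega>\<bar> \<partial>N) - 0) < e" if "k \<ge> k0" for k
    proof -
      have gB: "\<bar>g \<omega>\<bar> \<le> real n + \<bar>m\<bar>" for \<omega> using tr_le[of n \<omega>] by (simp add: g_def)
      have Xg_L2: "walk_avg g k 0 \<in> L2 N"
        by (rule bounded_L2[of _ "real n + \<bar>m\<bar>"], measurable) (simp add: walk_avg_def abs_funpow_avg_le gB)
      have split: "walk_avg f k 0 \<omega> = walk_avg g k 0 \<omega> + walk_avg (\<lambda>\<omega>. f \<omega> - g \<omega>) k 0 \<omega>" for \<omega>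
        unfolding walk_avg_def funpow_avg_diff by simp
      have "(\<integral>\<omega>. \<bar>walk_avg g k 0 \<omega>\<bar> \<partial>N) \<le> (\<integral>\<omega>. e / 8 + 2 / e * (walk_avg g k 0 \<omega>)\<^sup>2 \<partial>N)"
      proof (intro integral_mono)
        \<comment> \<open>The weight is chosen so that the target e / 4 splits into equal halves: 2
          / e times the square of e / 4 is again e / 8.\<close>
        have "\<bar>x\<bar> \<le> e / 8 + 2 / e * x\<^sup>2" for x :: real
        proof -
          have "0 \<le> 2 / e * (e / 4 - \<bar>x\<bar>)\<^sup>2" using e by simp
          also have "\<dots> = e / 8 - \<bar>x\<bar> + 2 / e * x\<^sup>2"
            using e by (simp add: power2_eq_square field_simps)
          finally show ?thesis by simp
        qed
        then show "\<bar>walk_avg g k 0 \<omega>\<bar> \<le> e / 8 + 2 / e * (walk_avg g k 0 \<omega>)\<^sup>2" for \<omega> .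
      qed (use walk_avg_integrable[OF g_int] L2_square[OF Xg_L2] in auto)
      also have "\<dots> = e / 8 + 2 / e * (\<integral>\<omega>. (walk_avg g k 0 \<omega>)\<^sup>2 \<partial>N)"
        using L2_square[OF Xg_L2] by (simp add: prob_space)
      also have "\<dots> < e / 8 + 2 / e * (e / 4)\<^sup>2"
        using k0[OF that] e by (intro add_strict_left_mono mult_strict_left_mono) auto
      also have "\<dots> = e / 4" using e by (simp add: power2_eq_square field_simps)
      finally have 1: "(\<integral>\<omega>. \<bar>walk_avg g k 0 \<omega>\<bar> \<partial>N) < e / 4" .
      have "(\<integral>\<omega>. \<bar>walk_avg f k 0 \<omega>\<bar> \<partial>N) \<le> (\<integral>\<omega>. \<bar>walk_avg g k 0 \<omega>\<bar> + \<bar>walk_avg (\<lambda>\<omega>. f \<omega> - g \<omega>) k 0 \<omega>\<bar> \<partial>N)"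
        using walk_avg_integrable[OF f] walk_avg_integrable[OF g_int] walk_avg_integrable[OF fg_int]
        by (intro integral_mono) (auto simp: split)
      also have "\<dots> = (\<integral>\<omega>. \<bar>walk_avg g k 0 \<omega>\<bar> \<partial>N) + (\<integral>\<omega>. \<bar>walk_avg (\<lambda>\<omega>. f \<omega> - g \<omega>) k 0 \<omega>\<bar> \<partial>N)"
        using walk_avg_integrable[OF g_int] walk_avg_integrable[OF fg_int] by simp
      finally show ?thesis using 1 rest[of k] e by simp
    qed
    then show "\<exists>no. \<forall>k\<ge>no. norm ((\<integral>\<omega>. \<bar>walk_avg f k 0 \<omega>\<bar> \<partial>N) - 0) < e" by blast
  qed
  moreover have "(\<integral>\<omega>. \<bar>walk_avg f k x \<omega>\<bar> \<partial>N) = (\<integral>\<omega>. \<bar>walk_avg f k 0 \<omega>\<bar> \<partial>N)" for k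
    using integral_act[of "\<lambda>\<omega>. \<bar>walk_avg f k 0 \<omega>\<bar>" x] by (simp add: walk_avg_act)
  ultimately show ?thesis by simp
qed

end

subsection \<open>The evolution and its limit\<close>

lemma finite_int_vec_box: "finite {x :: int ^ 'd::finite. \<forall>i. \<bar>x $ i\<bar> \<le> R}"
proof -
  have "finite (PiE (UNIV :: 'd set) (\<lambda>_. {-R..R}))" by (rule finite_PiE) auto
  moreover have "{x :: int ^ 'd. \<forall>i. \<bar>x $ i\<bar> \<le> R} \<subseteq> vec_lambda ` (PiE (UNIV :: 'd set) (\<lambda>_. {-R..R}))"
  proof
    fix x :: "int ^ 'd" assume "x \<in> {x. \<forall>i. \<bar>x $ i\<bar> \<le> R}"
    then have "x = vec_lambda (vec_nth x)" "vec_nth x \<in> PiE UNIV (\<lambda>_. {-R..R})"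
      by (auto simp: abs_le_iff minus_le_iff)
    then show "x \<in> vec_lambda ` (PiE (UNIV :: 'd set) (\<lambda>_. {-R..R}))" by blast
  qed
  ultimately show ?thesis by (rule finite_surj)
qed

text \<open>Bounded range confines the support to a finite box, so the total mass given by
  \<open>has_sum\<close> is a finite sum.\<close>

lemma kernel_walk:
  fixes p :: "int ^ 'd::finite \<Rightarrow> real"
  assumes "kernel p"
  shows "walk p"
proof
  show "0 \<le> p z" for z using assms by (simp add: kernel_def)
  obtain R :: int where R: "\<And>x. (\<exists>i. R < \<bar>x $ i\<bar>) \<Longrightarrow> p x = 0"
    using assms unfolding kernel_def by blast
  have "{z. p z \<noteq> 0} \<subseteq> {x. \<forall>i. \<bar>x $ i\<bar> \<le> R}" using R by (force simp: not_less[symmetric])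
  then show fin: "finite {z. p z \<noteq> 0}" using finite_int_vec_box by (rule finite_subset)
  have "(p has_sum (\<Sum>z | p z \<noteq> 0. p z)) UNIV"
    by (rule has_sum_finite_neutralI[OF fin]) auto
  moreover have "(p has_sum 1) UNIV" using assms by (simp add: kernel_def)
  ultimately show "(\<Sum>z | p z \<noteq> 0. p z) = 1" by (rule has_sum_unique)
qed

lemma kernel_generates: "kernel p \<Longrightarrow> subgroup_gen {u + x | x. 0 < p x} = UNIV"
  by (simp add: kernel_def)

section \<open>Infinite kernel sums as averages, and the solution of the recursion\<close>

context walk
begin

lemma infsum_kernel: "(\<Sum>\<^sub>\<infinity>z. p z * f (x + z)) = avg p f x"
  unfolding avg_def by (intro infsumI has_sum_finite_neutralI[OF p_finite]) auto

lemma infsum_kernel_shift: "(\<Sum>\<^sub>\<infinity>z. p (z - x) * f z) = avg p f x"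
proof -
  have "(\<Sum>\<^sub>\<infinity>z. p (z - x) * f z) = (\<Sum>\<^sub>\<infinity>z. p z * f (x + z))"
    by (rule infsum_reindex_bij_witness[of _ "\<lambda>z. x + z" "\<lambda>z. z - x"]) auto
  then show ?thesis by (simp add: infsum_kernel)
qed

end

lemma has_sum_sum:
  fixes f :: "'i \<Rightarrow> 'b \<Rightarrow> 'c::topological_comm_monoid_add"
  assumes "\<And>i. i \<in> I \<Longrightarrow> (f i has_sum s i) A"
  shows "((\<lambda>x. \<Sum>i\<in>I. f i x) has_sum (\<Sum>i\<in>I. s i)) A"
  using assms by (induction I rule: infinite_finite_induct) (auto intro: has_sum_add)

text \<open>\<open>pk\<close> recurses on the first step of the walk, and that step is the outermost
  \<open>avg\<close> of the iterate. The form with \<open>has_sum\<close> lets the two sums in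
  \<open>Delta0\<close> be subtracted.\<close>

lemma has_sum_pk:
  assumes "walk p"
  shows "((\<lambda>z. f z * pk p k x z) has_sum (avg p ^^ k) f x) UNIV"
proof (induction k arbitrary: x)
  case 0
  show ?case by (rule has_sum_finite_neutralI[of "{x}"]) auto
next
  case (Suc k)
  have "((\<lambda>z. \<Sum>w | p w \<noteq> 0. p w * (f z * pk p k (x + w) z)) has_sum
      (\<Sum>w | p w \<noteq> 0. p w * (avg p ^^ k) f (x + w))) UNIV"
    by (intro has_sum_sum has_sum_cmult_right Suc)
  moreover have "f z * pk p (Suc k) x z = (\<Sum>w | p w \<noteq> 0. p w * (f z * pk p k (x + w) z))" for z
    using walk.infsum_kernel_shift[OF assms, of x "\<lambda>w. pk p k w z"]
    by (simp add: avg_def sum_distrib_left mult.left_commute)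
  ultimately show ?case
    by (simp only: funpow.simps comp_def avg_def[of p "(avg p ^^ k) f"])
qed

text \<open>The contribution to the bond (x - e_i, x) of a noise field \<open>f\<close> that is
  \<open>k\<close> time steps old.\<close>

definition grad :: "(int ^ 'd::finite \<Rightarrow> real) \<Rightarrow> nat \<Rightarrow> (int ^ 'd \<Rightarrow> real) \<Rightarrow> int ^ 'd \<Rightarrow> 'd \<Rightarrow> real" where
  "grad p k f x i = (avg p ^^ k) f x - (avg p ^^ k) f (x - unit_vec i)"

lemma Delta0_eq:
  assumes "walk p"
  shows "Delta0 p \<xi> \<omega> x i = (\<Sum>k. grad p k (\<lambda>z. \<xi> (- int k) z \<omega>) x i)"
proof -
  have "(\<Sum>\<^sub>\<infinity>z. f z * (pk p k x z - pk p k y z)) = (avg p ^^ k) f x - (avg p ^^ k) f y" for f k y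
  proof (rule infsumI)
    show "((\<lambda>z. f z * (pk p k x z - pk p k y z)) has_sum (avg p ^^ k) f x - (avg p ^^ k) f y) UNIV"
      using has_sum_add[OF has_sum_pk[OF assms, of f k x] has_sum_uminusI[OF has_sum_pk[OF assms, of f k y]]]
      by (simp add: right_diff_distrib)
  qed
  then show ?thesis by (simp add: Delta0_def grad_def)
qed

text \<open>Averaging commutes with translations, so one time step only raises the age of the
  noise.\<close>

lemma avg_grad: "avg p (\<lambda>y. grad p k f y i) x = grad p (Suc k) f x i"
  unfolding grad_def avg_diff
  using avg_translate[of p "(avg p ^^ k) f" "- unit_vec i" x] by simp

text \<open>Variation of constants for one fixed realisation: \<open>u\<close> is a fixed point of
  averaging, the initial fluctuation is averaged \<open>t\<close> times, and noise of age
  \<open>k\<close> is averaged \<open>k\<close> times. Ages run below \<open>t\<close>, so exactly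
  the noise times 1 to \<open>t\<close> occur.\<close>

lemma evolution_eq:
  fixes \<eta> :: "nat \<Rightarrow> 'd::finite config" and \<xi> :: "int \<Rightarrow> int ^ 'd \<Rightarrow> real"
  assumes p: "walk p"
    and evol: "\<And>t x i. \<eta> (Suc t) x $ i = (\<Sum>\<^sub>\<infinity>z. p z * (\<eta> t (x + z) $ i))
                 + \<xi> (int t + 1) x - \<xi> (int t + 1) (x - unit_vec i)"
    and u: "u \<in> harmonic_d p"
  shows "\<eta> t x $ i = u x $ i + (avg p ^^ t) (\<lambda>y. \<eta> 0 y $ i - u y $ i) x
     + (\<Sum>k<t. grad p k (\<xi> (int t - int k)) x i)"
proof (induction t arbitrary: x)
  case (Suc t)
  have harm: "avg p (\<lambda>y. u y $ i) x = u x $ i"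
    using u walk.infsum_kernel_shift[OF p, of x "\<lambda>y. u y $ i"] by (simp add: harmonic_d_def)
  \<comment> \<open>The term \<open>k = 0\<close> is the noise just added; the index shift ages the
    remaining terms by one.\<close>
  have "(\<Sum>k<Suc t. grad p k (\<xi> (int (Suc t) - int k)) x i)
      = grad p 0 (\<xi> (int t + 1)) x i + (\<Sum>k<t. grad p (Suc k) (\<xi> (int t - int k)) x i)"
    unfolding sum.lessThan_Suc_shift by (simp add: add.commute)
  moreover have "\<eta> (Suc t) x $ i = avg p (\<lambda>y. \<eta> t y $ i) x + grad p 0 (\<xi> (int t + 1)) x i"
    unfolding evol walk.infsum_kernel[OF p, of "\<lambda>y. \<eta> t y $ i" x] by (simp add: grad_def)
  moreover have "avg p (\<lambda>y. \<eta> t y $ i) x = u x $ i + (avg p ^^ Suc t) (\<lambda>y. \<eta> 0 y $ i - u y $ i) x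
     + (\<Sum>k<t. grad p (Suc k) (\<xi> (int t - int k)) x i)"
    unfolding Suc by (simp add: avg_add avg_sum avg_grad harm)
  ultimately show ?case by simp
qed simp

section \<open>Measurability, convergence and subsequences for random configurations\<close>

lemma borel_measurable_config:
  fixes c :: "'a \<Rightarrow> 'd::finite config"
  assumes "\<And>x i. (\<lambda>\<omega>. c \<omega> x $ i) \<in> borel_measurable M"
  shows "c \<in> borel_measurable M"
proof (rule measurable_coordinatewise_then_product)
  show "(\<lambda>\<omega>. c \<omega> x) \<in> borel_measurable M" for x
    using assms by (subst borel_measurable_euclidean_space) (auto simp: Basis_vec_def inner_axis)
qed

lemma tendsto_config:
  fixes c :: "'a \<Rightarrow> 'd::finite config"
  assumes "\<And>x i. ((\<lambda>n. c n x $ i) \<longlongrightarrow> l x $ i) F"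
  shows "(c \<longlongrightarrow> l) F"
proof -
  have "limitin (product_topology (\<lambda>i. euclidean) UNIV) c l F"
    unfolding limitin_componentwise using assms by (auto intro: vec_tendstoI)
  then show ?thesis by (simp add: euclidean_product_topology)
qed


text \<open>If convergence fails, some \<open>s\<close> keeps all its values at distance at least
  \<open>e\<close> from \<open>L\<close>, which excludes any selection converging to
  \<open>L\<close>. Almost sure convergence along subsequences can thus decide the convergence of a
  full sequence of integrals.\<close>

lemma LIMSEQ_via_subseq:
  fixes a :: "nat \<Rightarrow> real"
  assumes "\<And>s. (\<And>n. n \<le> s n) \<Longrightarrow> \<exists>r. (\<lambda>n. a (s (r n))) \<longlonglongrightarrow> L"
  shows "a \<longlonglongrightarrow> L"
proof (rule ccontr)
  assume "\<not> a \<longlonglongrightarrow> L"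
  then obtain e where e: "e > 0" "\<And>N. \<exists>n\<ge>N. e \<le> dist (a n) L"
    unfolding lim_sequentially by (metis not_le)
  from e(2) obtain s where s: "\<And>n. n \<le> s n" "\<And>n. e \<le> dist (a (s n)) L" by metis
  from assms[OF s(1)] obtain r where "(\<lambda>n. a (s (r n))) \<longlonglongrightarrow> L" by blast
  then obtain n where "dist (a (s (r n))) L < e"
    using e(1) unfolding lim_sequentially by blast
  with s(2)[of "r n"] show False by simp
qed

lemma filterlim_ge_id: "(\<And>n. n \<le> s n) \<Longrightarrow> filterlim s at_top sequentially" for s :: "nat \<Rightarrow> nat"
  by (rule filterlim_at_top_mono[OF filterlim_ident]) auto

text \<open>A diagonal choice: at stage \<open>n\<close> the finitely many coordinates with code at
  most \<open>n\<close> get L1 norms below \<open>(1/2) ^ n\<close>. Each coordinate is covered from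
  stage \<open>to_nat c\<close> on, so a single subsequence serves all.\<close>

lemma AE_subseq_countable:
  fixes A :: "nat \<Rightarrow> 'c::countable \<Rightarrow> 'a \<Rightarrow> real"
  assumes int: "\<And>t c. integrable M (A t c)"
    and lim: "\<And>c. (\<lambda>t. \<integral>\<omega>. \<bar>A t c \<omega>\<bar> \<partial>M) \<longlonglongrightarrow> 0"
  shows "\<exists>r. (\<forall>n. n \<le> r n) \<and> (AE \<omega> in M. \<forall>c. (\<lambda>n. A (r n) c \<omega>) \<longlonglongrightarrow> 0)"
proof -
  have "\<exists>t\<ge>n. \<forall>c\<in>{c. to_nat c \<le> n}. (\<integral>\<omega>. \<bar>A t c \<omega>\<bar> \<partial>M) < (1/2) ^ n" for n
  proof -
    have "finite {c :: 'c. to_nat c \<le> n}"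
      using finite_vimageI[OF finite_atMost[of n] inj_to_nat[where 'a='c]] by (simp add: vimage_def)
    then have "\<forall>\<^sub>F t in sequentially. \<forall>c\<in>{c. to_nat c \<le> n}. (\<integral>\<omega>. \<bar>A t c \<omega>\<bar> \<partial>M) < (1/2) ^ n"
      by (rule eventually_ball_finite) (auto intro!: order_tendstoD(2)[OF lim])
    then have "\<forall>\<^sub>F t in sequentially. n \<le> t \<and> (\<forall>c\<in>{c. to_nat c \<le> n}. (\<integral>\<omega>. \<bar>A t c \<omega>\<bar> \<partial>M) < (1/2) ^ n)"
      using eventually_ge_at_top by (rule eventually_conj[rotated])
    then show ?thesis using eventually_happens by fastforce
  qed
  then obtain r where r: "\<And>n. n \<le> r n"
    "\<And>n c. to_nat c \<le> n \<Longrightarrow> (\<integral>\<omega>. \<bar>A (r n) c \<omega>\<bar> \<partial>M) < (1/2) ^ n"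
    by (metis mem_Collect_eq)
  have "AE \<omega> in M. summable (\<lambda>n. \<bar>A (r n) c \<omega>\<bar>)" for c
  proof (rule AE_summable_abs[OF int])
    have "summable (\<lambda>n. (1/2::real) ^ n)" by (intro summable_geometric) simp
    then show "summable (\<lambda>n. \<integral>\<omega>. \<bar>A (r n) c \<omega>\<bar> \<partial>M)"
      by (rule summable_comparison_test'[where N="to_nat c"]) (use r(2) in \<open>auto intro: less_imp_le\<close>)
  qed
  then have "AE \<omega> in M. \<forall>c. summable (\<lambda>n. \<bar>A (r n) c \<omega>\<bar>)" by (simp add: AE_all_countable)
  then have "AE \<omega> in M. \<forall>c. (\<lambda>n. A (r n) c \<omega>) \<longlonglongrightarrow> 0"
    by eventually_elim (metis summable_LIMSEQ_zero tendsto_rabs_zero_cancel)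
  with r(1) show ?thesis by blast
qed

lemma (in prob_space) distr_pair_snd:
  assumes "sigma_finite_measure N"
  shows "distr (M \<Otimes>\<^sub>M N) N snd = N"
proof -
  interpret N: sigma_finite_measure N by fact
  show ?thesis
  proof (intro measure_eqI)
    fix A assume A: "A \<in> sets (distr (M \<Otimes>\<^sub>M N) N snd)"
    then have "emeasure (distr (M \<Otimes>\<^sub>M N) N snd) A = emeasure (M \<Otimes>\<^sub>M N) (space M \<times> A)"
      by (auto simp: emeasure_distr space_pair_measure dest: sets.sets_into_space intro!: arg_cong2[where f=emeasure])
    with A show "emeasure (distr (M \<Otimes>\<^sub>M N) N snd) A = emeasure N A"
      by (simp add: N.emeasure_pair_measure_Times emeasure_space_1)
  qed simp
qed

lemma borel_measurable_config_component [measurable]: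
  "(\<lambda>c :: 'd::finite config. c x $ i) \<in> borel_measurable borel"
  by (intro borel_measurable_continuous_onI continuous_on_component continuous_on_product_coordinates)

section \<open>Almost sure convergence of the series defining \<open>Delta0\<close>\<close>

locale iid_noise = prob_space M
  for M :: "'a measure" and p :: "int ^ 'd::finite \<Rightarrow> real" and \<xi> :: "int \<Rightarrow> int ^ 'd \<Rightarrow> 'a \<Rightarrow> real" +
  assumes p: "kernel p"
    and xi_indep: "indep_vars (\<lambda>_. borel) (\<lambda>(t, x). \<xi> t x) UNIV"
    and xi_ident: "distr M borel (\<xi> t x) = distr M borel (\<xi> 0 0)"
    and xi_mean: "expectation (\<xi> 0 0) = 0"
    and xi_var: "integrable M (\<lambda>\<omega>. (\<xi> 0 0 \<omega>)\<^sup>2)"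
begin

sublocale walk p using p by (rule kernel_walk)

lemma xi_measurable [measurable]: "\<xi> t x \<in> borel_measurable M"
  using xi_indep unfolding indep_vars_def by auto

lemma integral_xi:
  fixes g :: "real \<Rightarrow> real"
  assumes [measurable]: "g \<in> borel_measurable borel"
  shows "(\<integral>\<omega>. g (\<xi> t x \<omega>) \<partial>M) = (\<integral>\<omega>. g (\<xi> 0 0 \<omega>) \<partial>M)"
  using integral_distr[OF xi_measurable assms, of t x] integral_distr[OF xi_measurable assms, of 0 0]
  by (simp add: xi_ident[of t x])

lemma integrable_xi:
  fixes g :: "real \<Rightarrow> real"
  assumes [measurable]: "g \<in> borel_measurable borel"
  shows "integrable M (\<lambda>\<omega>. g (\<xi> t x \<omega>)) \<longleftrightarrow> integrable M (\<lambda>\<omega>. g (\<xi> 0 0 \<omega>))"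
  using integrable_distr_eq[OF xi_measurable assms, of t x] integrable_distr_eq[OF xi_measurable assms, of 0 0]
  by (simp add: xi_ident[of t x])

lemma xi_L2: "\<xi> t x \<in> L2 M"
  using integrable_xi[of "\<lambda>x. x\<^sup>2" t x] xi_var by (simp add: L2_def)

lemma xi_centered: "expectation (\<xi> t x) = 0"
  using integral_xi[of "\<lambda>x. x" t x] xi_mean by simp

text \<open>Independence and zero mean remove the off-diagonal terms. The right side is translation
  invariant and free of \<open>t\<close>, so the noise fields at all times share one stationary
  covariance.\<close>

lemma xi_covariance:
  "(\<integral>\<omega>. \<xi> t x \<omega> * \<xi> t y \<omega> \<partial>M) = (if x = y then \<integral>\<omega>. \<xi> 0 0 \<omega> * \<xi> 0 0 \<omega> \<partial>M else 0)"
proof (cases "x = y")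
  case True
  then show ?thesis using integral_xi[of "\<lambda>x. x * x" t x] by simp
next
  case False
  let ?I = "{(t, x), (t, y)}"
  have "(\<integral>\<omega>. (\<Prod>i\<in>?I. (case i of (t, x) \<Rightarrow> \<xi> t x) \<omega>) \<partial>M) = (\<Prod>i\<in>?I. \<integral>\<omega>. (case i of (t, x) \<Rightarrow> \<xi> t x) \<omega> \<partial>M)"
    by (rule indep_vars_lebesgue_integral) (auto intro: indep_vars_subset[OF xi_indep] L2_integrable xi_L2)
  then show ?thesis using False by (simp add: xi_centered)
qed

lemma xi_wide_stationary: "wide_stationary M (\<xi> t)"
  by (simp add: wide_stationary_def xi_L2 xi_covariance)

text \<open>Term \<open>k\<close> uses the noise at time \<open>- int k\<close>, a different field
  for each \<open>k\<close>, while \<open>summable_square_increment\<close> follows a single field.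
  Equal covariances allow every term to be computed from the noise at time 0.\<close>

lemma grad_summable_variance:
  "summable (\<lambda>k. expectation (\<lambda>\<omega>. (grad p k (\<lambda>z. \<xi> (- int k) z \<omega>) x i)\<^sup>2))"
proof -
  have "expectation (\<lambda>\<omega>. (grad p k (\<lambda>z. \<xi> (- int k) z \<omega>) x i)\<^sup>2)
      = expectation (\<lambda>\<omega>. ((avg p ^^ k) (\<lambda>z. \<xi> 0 z \<omega>) x - (avg p ^^ k) (\<lambda>z. \<xi> 0 z \<omega>) (x - unit_vec i))\<^sup>2)" for k
  proof -
    have cov: "(\<integral>\<omega>. (avg p ^^ k) (\<lambda>z. \<xi> (- int k) z \<omega>) a * (avg p ^^ k) (\<lambda>z. \<xi> (- int k) z \<omega>) b \<partial>M)
      = (\<integral>\<omega>. (avg p ^^ k) (\<lambda>z. \<xi> 0 z \<omega>) a * (avg p ^^ k) (\<lambda>z. \<xi> 0 z \<omega>) b \<partial>M)" for a b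
      by (rule covariance_funpow_avg_cong) (simp_all add: xi_L2 xi_covariance)
    have L: "(\<lambda>\<omega>. (avg p ^^ k) (\<lambda>z. \<xi> t z \<omega>) a) \<in> L2 M" for t a
      by (rule L2_funpow_avg[OF xi_L2])
    show ?thesis unfolding grad_def integral_square_diff[OF L L] cov ..
  qed
  then show ?thesis
    using summable_square_increment[OF xi_wide_stationary[of 0] kernel_generates[OF p], of x "x - unit_vec i"]
    by simp
qed

lemma grad_centered: "expectation (\<lambda>\<omega>. grad p k (\<lambda>z. \<xi> t z \<omega>) x i) = 0"
proof -
  have int: "integrable M (\<lambda>\<omega>. (avg p ^^ n) (\<lambda>z. \<xi> t z \<omega>) y)" for n y
    by (intro integrable_funpow_avg L2_integrable xi_L2)
  have "expectation (\<lambda>\<omega>. (avg p ^^ n) (\<lambda>z. \<xi> t z \<omega>) y) = 0" for n y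
  proof (induction n arbitrary: y)
    case (Suc n)
    have "expectation (\<lambda>\<omega>. (avg p ^^ Suc n) (\<lambda>z. \<xi> t z \<omega>) y)
        = (\<Sum>w | p w \<noteq> 0. p w * expectation (\<lambda>\<omega>. (avg p ^^ n) (\<lambda>z. \<xi> t z \<omega>) (y + w)))"
      unfolding funpow.simps comp_def avg_def[of p "(avg p ^^ n) _"]
      using int by (simp add: Bochner_Integration.integral_sum)
    then show ?case by (simp add: Suc)
  qed (simp add: xi_centered)
  then show ?thesis using int by (simp add: grad_def)
qed

lemma borel_measurable_grad:
  assumes "\<And>z. (\<lambda>w. Y z w) \<in> borel_measurable N"
  shows "(\<lambda>w. grad p k (\<lambda>z. Y z w) x i) \<in> borel_measurable N"
  unfolding grad_def by (intro borel_measurable_diff borel_measurable_funpow_avg assms)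

text \<open>Term \<open>k\<close> reads only the time slice \<open>- int k\<close>, and these slices
  are disjoint.\<close>

lemma grad_indep: "indep_vars (\<lambda>_. borel) (\<lambda>k \<omega>. grad p k (\<lambda>z. \<xi> (- int k) z \<omega>) x i) UNIV"
proof -
  let ?K = "\<lambda>k :: nat. {- int k} \<times> (UNIV :: (int ^ 'd) set)"
  have "indep_vars (\<lambda>k. PiM (?K k) (\<lambda>_. borel)) (\<lambda>k \<omega>. \<lambda>j\<in>?K k. (case j of (t, x) \<Rightarrow> \<xi> t x) \<omega>) UNIV"
    by (rule indep_vars_restrict[OF xi_indep]) (auto simp: disjoint_family_on_def)
  then have "indep_vars (\<lambda>_. borel) (\<lambda>k \<omega>. grad p k (\<lambda>z. (\<lambda>j\<in>?K k. (case j of (t, x) \<Rightarrow> \<xi> t x) \<omega>) (- int k, z)) x i) UNIV"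
  proof (rule indep_vars_compose2[where Y="\<lambda>k \<psi>. grad p k (\<lambda>z. \<psi> (- int k, z)) x i"])
    show "(\<lambda>\<psi>. grad p k (\<lambda>z. \<psi> (- int k, z)) x i) \<in> borel_measurable (PiM (?K k) (\<lambda>_. borel))" for k
      by (intro borel_measurable_grad measurable_component_singleton) auto
  qed
  then show ?thesis by simp
qed

lemma AE_summable_Delta0: "AE \<omega> in M. summable (\<lambda>k. grad p k (\<lambda>z. \<xi> (- int k) z \<omega>) x i)"
proof (rule kolmogorov_one_series[OF grad_indep _ grad_centered grad_summable_variance])
  show "(\<lambda>\<omega>. grad p k (\<lambda>z. \<xi> (- int k) z \<omega>) x i) \<in> L2 M" for k
    unfolding grad_def by (intro L2_diff L2_funpow_avg xi_L2)
qed

end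

lemma shift_component: "shift a c x $ i = c (x + a) $ i"
  by (simp add: shift_def)

text \<open>This is \<open>mean_ergodic_L1\<close> on configuration space for the observable
  \<open>c 0 $ i\<close>, whose values along the shift orbit are the coordinates
  \<open>c y $ i\<close>.\<close>

lemma stationary_ergodic_average:
  fixes p :: "int ^ 'd::finite \<Rightarrow> real" and \<nu> :: "'d config measure"
  assumes p: "kernel p" and \<nu>: "prob_space \<nu>" "sets \<nu> = sets borel"
    and inv: "shift_invariant \<nu>" and erg: "shift_ergodic \<nu>"
    and int: "integrable \<nu> (\<lambda>c. c 0 $ i)" and mean: "(\<integral>c. c 0 $ i \<partial>\<nu>) = 0"
  shows "(\<lambda>t. \<integral>c. \<bar>(avg p ^^ t) (\<lambda>y. c y $ i) x\<bar> \<partial>\<nu>) \<longlonglongrightarrow> 0"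
proof -
  interpret prob_space \<nu> by fact
  interpret walk p using p by (rule kernel_walk)
  have shift_meas: "shift a \<in> measurable borel borel" for a :: "int ^ 'd"
    by (intro borel_measurable_config) (simp add: shift_component)
  have sp: "space \<nu> = UNIV" using \<nu>(2) by (metis sets_eq_imp_space_eq space_borel)
  interpret ergodic_walk \<nu> p shift
  proof
    fix a b :: "int ^ 'd" and c :: "'d config"
    show "shift a \<in> measurable \<nu> \<nu>"
      using shift_meas by (simp add: measurable_cong_sets[OF \<nu>(2) \<nu>(2)])
    show "shift (a + b) c = shift a (shift b c)"
      by (simp add: shift_def add.assoc)
    have "distr \<nu> \<nu> (shift a) = distr \<nu> borel (shift a)"
      by (rule distr_cong) (simp_all add: \<nu>)
    then show "distr \<nu> \<nu> (shift a) = \<nu>" using inv by (simp add: shift_invariant_def)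
  next
    fix A assume A: "A \<in> events" "\<And>a \<omega>. \<omega> \<in> space \<nu> \<Longrightarrow> (shift a \<omega> \<in> A) = (\<omega> \<in> A)"
    then have "\<forall>a. shift a -` A = A" by (auto simp: sp)
    with A(1) erg have "emeasure \<nu> A = 0 \<or> emeasure \<nu> A = 1"
      unfolding shift_ergodic_def \<nu>(2) by blast
    then show "prob A = 0 \<or> prob A = 1" by (auto simp: measure_def)
  qed (rule kernel_generates[OF p])
  show ?thesis
    using mean_ergodic_L1[OF int mean, of x] by (simp add: walk_avg_def[abs_def] shift_component)
qed

section \<open>Joint law of the initial state and the time-shifted noise\<close>

context iid_noise
begin

definition future :: "(int \<times> (int ^ 'd)) set" where
  "future = {1..} \<times> UNIV"

text \<open>Only the noise at times s at least 1 is independent of the initial state. Moving the origin of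
  time by t turns the time-t noise term of the evolution into the t-th partial sum of \<open>\<Delta>\<^sub>0\<close>.\<close>
definition noise :: "int \<Rightarrow> 'a \<Rightarrow> int \<times> (int ^ 'd) \<Rightarrow> real" where
  "noise t \<omega> = (\<lambda>n\<in>future. \<xi> (fst n - t) (snd n) \<omega>)"

lemma noise_measurable [measurable]: "noise t \<in> measurable M (PiM future (\<lambda>_. borel))"
  unfolding noise_def[abs_def] by (rule measurable_restrict) simp

text \<open>The whole noise field is a product of equal marginals, and restricting such a product
  along an injective relabelling of coordinates gives a product again. The law is therefore the same
  for every \<open>t\<close>.\<close>

lemma distr_noise: "distr M (PiM future (\<lambda>_. borel)) (noise t) = PiM future (\<lambda>_. distr M borel (\<xi> 0 0))"
proof -
  let ?\<nu> = "distr M borel (\<xi> 0 0)"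
  let ?\<Xi> = "\<lambda>\<omega>. \<lambda>n\<in>UNIV. (case n of (s, z) \<Rightarrow> \<xi> s z) \<omega>"
  let ?f = "\<lambda>n :: int \<times> (int ^ 'd). (fst n - t, snd n)"
  have sets_eq: "sets (PiM I (\<lambda>_. ?\<nu>)) = sets (PiM I (\<lambda>_. borel))" for I :: "(int \<times> (int ^ 'd)) set"
    by (intro sets_PiM_cong) auto
  have \<Xi>: "distr M (PiM UNIV (\<lambda>_. borel)) ?\<Xi> = PiM UNIV (\<lambda>_. ?\<nu>)"
  proof -
    have "distr M (PiM UNIV (\<lambda>_. borel)) ?\<Xi> = PiM UNIV (\<lambda>n. distr M borel (case n of (s, z) \<Rightarrow> \<xi> s z))"
      using xi_indep by (subst (asm) indep_vars_iff_distr_eq_PiM') (auto split: prod.splits)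
    also have "\<dots> = PiM UNIV (\<lambda>_. ?\<nu>)"
      by (intro PiM_cong refl) (use xi_ident in \<open>auto split: prod.splits\<close>)
    finally show ?thesis .
  qed
  have \<Xi>_meas: "?\<Xi> \<in> measurable M (PiM UNIV (\<lambda>_. borel))"
    by (rule measurable_restrict) (auto split: prod.splits)
  have re_meas: "(\<lambda>\<psi>. \<lambda>n\<in>future. \<psi> (?f n)) \<in> measurable (PiM UNIV (\<lambda>_. borel)) (PiM future (\<lambda>_. borel))"
    by (intro measurable_restrict measurable_component_singleton) auto
  have "distr M (PiM future (\<lambda>_. borel)) (noise t)
      = distr (distr M (PiM UNIV (\<lambda>_. borel)) ?\<Xi>) (PiM future (\<lambda>_. borel)) (\<lambda>\<psi>. \<lambda>n\<in>future. \<psi> (?f n))"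
    unfolding distr_distr[OF re_meas \<Xi>_meas] noise_def[abs_def] by (simp add: comp_def)
  also have "\<dots> = distr (PiM UNIV (\<lambda>_. ?\<nu>)) (PiM future (\<lambda>_. ?\<nu>)) (\<lambda>\<psi>. \<lambda>n\<in>future. \<psi> (?f n))"
    unfolding \<Xi> by (rule distr_cong) (simp_all add: sets_eq)
  also have "\<dots> = PiM future (\<lambda>_. ?\<nu>)"
    by (rule distr_PiM_reindex[of UNIV "\<lambda>_. ?\<nu>" ?f]) (auto intro!: prob_space_distr simp: inj_on_def prod_eq_iff)
  finally show ?thesis .
qed

text \<open>\<open>noise 0\<close> is measurable for the sigma-algebra generated by the noise at
  times at least 1. The assumed independence then gives the product formula on rectangles, which
  determine the joint law.\<close>

lemma distr_config_noise:
  fixes c :: "'a \<Rightarrow> 'd config"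
  assumes c [measurable]: "c \<in> borel_measurable M"
    and indep: "indep_set {c -` S \<inter> space M | S. S \<in> sets borel}
      (sigma_sets (space M) (\<Union>s\<in>{1..}. \<Union>x. {\<xi> s x -` S \<inter> space M | S. S \<in> sets borel}))"
  shows "distr M borel c \<Otimes>\<^sub>M distr M (PiM future (\<lambda>_. borel)) (noise 0)
    = distr M (borel \<Otimes>\<^sub>M PiM future (\<lambda>_. borel)) (\<lambda>\<omega>. (c \<omega>, noise 0 \<omega>))"
proof -
  define \<G> where "\<G> = (\<Union>s\<in>{1..}. \<Union>x. {\<xi> s x -` S \<inter> space M | S. S \<in> sets borel})"
  have G: "\<G> \<subseteq> Pow (space M)" unfolding \<G>_def by auto
  have meas: "noise 0 \<in> measurable (sigma (space M) \<G>) (PiM future (\<lambda>_. borel))"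
    unfolding noise_def[abs_def]
  proof (rule measurable_restrict)
    fix n :: "int \<times> (int ^ 'd)" assume "n \<in> future"
    then have n: "fst n \<ge> 1" by (auto simp: future_def)
    have "\<xi> (fst n) (snd n) \<in> borel_measurable (sigma (space M) \<G>)"
    proof (rule measurableI)
      fix S :: "real set" assume "S \<in> sets borel"
      then have "\<xi> (fst n) (snd n) -` S \<inter> space M \<in> \<G>" unfolding \<G>_def using n by auto
      then show "\<xi> (fst n) (snd n) -` S \<inter> space (sigma (space M) \<G>) \<in> sets (sigma (space M) \<G>)"
        using G by (simp add: space_measure_of_conv sets_measure_of sigma_sets.Basic)
    qed simp
    then show "\<xi> (fst n - 0) (snd n) \<in> borel_measurable (sigma (space M) \<G>)" by simp
  qed
  have Y: "noise 0 -` A \<inter> space M \<in> sigma_sets (space M) \<G>" if "A \<in> sets (PiM future (\<lambda>_. borel))" for A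
    using measurable_sets[OF meas that] G by (simp add: space_measure_of_conv sets_measure_of)
  show ?thesis
  proof (rule pair_measure_eqI)
    fix A :: "'d config set" and B
    assume "A \<in> sets (distr M borel c)" "B \<in> sets (distr M (PiM future (\<lambda>_. borel)) (noise 0))"
    then have [measurable]: "A \<in> sets borel" "B \<in> sets (PiM future (\<lambda>_. borel))" by auto
    have "c -` A \<inter> space M \<in> {c -` S \<inter> space M | S. S \<in> sets borel}" by auto
    then have "prob ((c -` A \<inter> space M) \<inter> (noise 0 -` B \<inter> space M))
        = prob (c -` A \<inter> space M) * prob (noise 0 -` B \<inter> space M)"
      using indep Y[of B] unfolding indep_sets2_eq \<G>_def[symmetric] by simp
    moreover have "(c -` A \<inter> space M) \<inter> (noise 0 -` B \<inter> space M)
        = (\<lambda>\<omega>. (c \<omega>, noise 0 \<omega>)) -` (A \<times> B) \<inter> space M" by auto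
    ultimately show "emeasure (distr M borel c) A * emeasure (distr M (PiM future (\<lambda>_. borel)) (noise 0)) B
        = emeasure (distr M (borel \<Otimes>\<^sub>M PiM future (\<lambda>_. borel)) (\<lambda>\<omega>. (c \<omega>, noise 0 \<omega>))) (A \<times> B)"
      by (simp add: emeasure_distr emeasure_eq_measure ennreal_mult'')
  qed (auto intro!: prob_space_imp_sigma_finite prob_space_distr simp: sets_pair_measure)
qed

text \<open>The joint law is a product and the law of the noise is the same for every
  \<open>t\<close>. So the noise may be replaced by a copy on a second factor with its time origin
  moved by \<open>t\<close>, and convergence in law becomes a question about almost sure limits on
  one space.\<close>

lemma integral_config_noise:
  fixes c :: "'a \<Rightarrow> 'd config" and H :: "'d config \<times> (int \<times> (int ^ 'd) \<Rightarrow> real) \<Rightarrow> real"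
  assumes c [measurable]: "c \<in> borel_measurable M"
    and indep: "indep_set {c -` S \<inter> space M | S. S \<in> sets borel}
      (sigma_sets (space M) (\<Union>s\<in>{1..}. \<Union>x. {\<xi> s x -` S \<inter> space M | S. S \<in> sets borel}))"
    and H [measurable]: "H \<in> borel_measurable (borel \<Otimes>\<^sub>M PiM future (\<lambda>_. borel))"
  shows "(\<integral>\<omega>. H (c \<omega>, noise 0 \<omega>) \<partial>M) = (\<integral>w. H (c (fst w), noise t (snd w)) \<partial>(M \<Otimes>\<^sub>M M))"
proof -
  let ?N = "PiM future (\<lambda>_. borel) :: (int \<times> (int ^ 'd) \<Rightarrow> real) measure"
  have "distr M (borel \<Otimes>\<^sub>M ?N) (\<lambda>\<omega>. (c \<omega>, noise 0 \<omega>)) = distr M borel c \<Otimes>\<^sub>M distr M ?N (noise 0)"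
    by (rule distr_config_noise[OF c indep, symmetric])
  also have "\<dots> = distr M borel c \<Otimes>\<^sub>M distr M ?N (noise t)"
    by (simp add: distr_noise)
  also have "\<dots> = distr (M \<Otimes>\<^sub>M M) (borel \<Otimes>\<^sub>M ?N) (\<lambda>(x, y). (c x, noise t y))"
    by (intro pair_measure_distr prob_space_imp_sigma_finite prob_space_distr) measurable
  finally have eq: "distr M (borel \<Otimes>\<^sub>M ?N) (\<lambda>\<omega>. (c \<omega>, noise 0 \<omega>))
      = distr (M \<Otimes>\<^sub>M M) (borel \<Otimes>\<^sub>M ?N) (\<lambda>(x, y). (c x, noise t y))" .
  have "(\<integral>\<omega>. H (c \<omega>, noise 0 \<omega>) \<partial>M) = (\<integral>h. H h \<partial>distr M (borel \<Otimes>\<^sub>M ?N) (\<lambda>\<omega>. (c \<omega>, noise 0 \<omega>)))"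
    by (rule integral_distr[symmetric]) measurable
  also have "\<dots> = (\<integral>w. H (case w of (x, y) \<Rightarrow> (c x, noise t y)) \<partial>(M \<Otimes>\<^sub>M M))"
    unfolding eq by (rule integral_distr) measurable
  finally show ?thesis by (simp add: case_prod_beta)
qed

lemma Delta0_measurable: "(\<lambda>\<omega>. Delta0 p \<xi> \<omega> x i) \<in> borel_measurable M"
  unfolding Delta0_eq[OF walk_axioms] by (intro borel_measurable_suminf borel_measurable_grad) simp

end


section \<open>Weak convergence through a coupling on a product space\<close>

theorem theorem2p5:
  fixes M :: "'a measure"
    and p :: "int ^ 'd::finite \<Rightarrow> real"
    and \<xi> :: "int \<Rightarrow> int ^ 'd \<Rightarrow> 'a \<Rightarrow> real"
    and \<eta> :: "nat \<Rightarrow> 'a \<Rightarrow> 'd config"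
    and \<zeta> :: "'a \<Rightarrow> 'd config"
    and u :: "int ^ 'd \<Rightarrow> real ^ 'd"
  assumes M: "prob_space M"
    and p: "kernel p"
    and xi_indep: "prob_space.indep_vars M (\<lambda>_. borel) (\<lambda>(t, x). \<xi> t x) UNIV"
    and xi_ident: "\<forall>t x. distr M borel (\<xi> t x) = distr M borel (\<xi> 0 0)"
    and xi_mean: "integrable M (\<xi> 0 0)" "integral\<^sup>L M (\<xi> 0 0) = 0"
    and xi_var: "integrable M (\<lambda>\<omega>. (\<xi> 0 0 \<omega>)\<^sup>2)"
    and evol: "\<forall>t \<omega> x i. \<eta> (Suc t) \<omega> x $ i =
                 (\<Sum>\<^sub>\<infinity>z. p z * (\<eta> t \<omega> (x + z) $ i))
                 + \<xi> (int t + 1) x \<omega> - \<xi> (int t + 1) (x - unit_vec i) \<omega>"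
    and indep0: "prob_space.indep_set M
                   {\<eta> 0 -` S \<inter> space M | S. S \<in> sets borel}
                   (sigma_sets (space M)
                      (\<Union>s\<in>{1..}. \<Union>x. {\<xi> s x -` S \<inter> space M | S. S \<in> sets borel}))"
    and eta0_meas: "\<eta> 0 \<in> borel_measurable M"
    and u: "u \<in> harmonic_d p"
    and init: "\<forall>\<omega> x i. \<eta> 0 \<omega> x $ i = u x $ i + \<zeta> \<omega> x $ i"
    and zeta_meas: "\<zeta> \<in> borel_measurable M"
    and zeta_inv: "shift_invariant (distr M borel \<zeta>)"
    and zeta_erg: "shift_ergodic (distr M borel \<zeta>)"
    and zeta_mean: "\<forall>x i. integrable M (\<lambda>\<omega>. \<zeta> \<omega> x $ i) \<and> integral\<^sup>L M (\<lambda>\<omega>. \<zeta> \<omega> x $ i) = 0"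
  shows "weak_conv (\<lambda>t. distr M borel (\<eta> t)) (pi_u M p \<xi> u)"
proof -
  interpret prob_space M by (rule M)
  interpret iid_noise M p \<xi>
    using assms by unfold_locales auto
  interpret P: pair_prob_space M M ..
  have [measurable]: "\<eta> 0 \<in> borel_measurable M" "\<zeta> \<in> borel_measurable M"
    by (fact eta0_meas zeta_meas)+
  \<comment> \<open>With \<open>D\<close> and \<open>\<Phi>\<close> the state at time
    \<open>t\<close> becomes a fixed function of the initial configuration and an abstract noise
    \<open>\<psi>\<close>, so its law can be computed from any pair with the same joint law.\<close>
  define D where "D t \<psi> x i = (\<Sum>k<t. grad p k (\<lambda>z. \<psi> (int t - int k, z)) x i)"
    for t :: nat and \<psi> x i
  define \<Phi> where "\<Phi> t h = (\<lambda>x. \<chi> i. u x $ i + (avg p ^^ t) (\<lambda>y. fst h y $ i - u y $ i) x + D t (snd h) x i)"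
    for t :: nat and h :: "'d config \<times> (int \<times> (int ^ 'd) \<Rightarrow> real)"
  have \<Phi>_meas [measurable]: "\<Phi> t \<in> borel_measurable (borel \<Otimes>\<^sub>M PiM future (\<lambda>_. borel))" for t
  proof (rule borel_measurable_config)
    fix x i
    have "(\<lambda>h. (avg p ^^ t) (\<lambda>y. fst h y $ i - u y $ i) x) \<in> borel_measurable (borel \<Otimes>\<^sub>M PiM future (\<lambda>_. borel))"
      by (rule borel_measurable_funpow_avg) measurable
    moreover have "(\<lambda>h. D t (snd h) x i) \<in> borel_measurable ((borel :: 'd config measure) \<Otimes>\<^sub>M PiM future (\<lambda>_. borel))"
      unfolding D_def
      by (intro borel_measurable_sum borel_measurable_grad
          measurable_compose[OF measurable_snd measurable_component_singleton]) (auto simp: future_def)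
    ultimately show "(\<lambda>h. \<Phi> t h x $ i) \<in> borel_measurable (borel \<Otimes>\<^sub>M PiM future (\<lambda>_. borel))"
      unfolding \<Phi>_def vec_lambda_beta by (intro borel_measurable_add borel_measurable_const)
  qed
  have D_noise0: "D t (noise 0 \<omega>) x i = (\<Sum>k<t. grad p k (\<lambda>z. \<xi> (int t - int k) z \<omega>) x i)" for t \<omega> x i
    unfolding D_def by (intro sum.cong refl) (simp add: noise_def future_def)
  \<comment> \<open>With the origin moved by \<open>t\<close>, the noise time
    \<open>int t - int k\<close> becomes \<open>- int k\<close>, the time used by term
    \<open>k\<close> of \<open>Delta0\<close>.\<close>
  have D_noise: "D t (noise (int t) \<omega>) x i = (\<Sum>k<t. grad p k (\<lambda>z. \<xi> (- int k) z \<omega>) x i)" for t \<omega> x i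
    unfolding D_def by (intro sum.cong refl) (simp add: noise_def future_def)
  have \<eta>_eq: "\<eta> t \<omega> = \<Phi> t (\<eta> 0 \<omega>, noise 0 \<omega>)" for t \<omega>
    unfolding \<Phi>_def D_noise0 snd_conv fst_conv fun_eq_iff vec_eq_iff
    using evolution_eq[OF walk_axioms _ u, of "\<lambda>t. \<eta> t \<omega>" "\<lambda>s z. \<xi> s z \<omega>" t] evol by simp
  have \<eta>_meas [measurable]: "\<eta> t \<in> borel_measurable M" for t
  proof -
    have "(\<lambda>\<omega>. \<Phi> t (\<eta> 0 \<omega>, noise 0 \<omega>)) \<in> borel_measurable M" by measurable
    then show ?thesis unfolding \<eta>_eq[symmetric] .
  qed
  \<comment> \<open>Site and direction are paired into one countable index \<open>c\<close>, so that
    a single subsequence can serve all of them.\<close>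
  define A where "A t c \<omega> = (avg p ^^ t) (\<lambda>y. \<zeta> \<omega> y $ snd c) (fst c)" for t :: nat and c \<omega>
  \<comment> \<open>A copy of the state at time \<open>t\<close> with initial state and noise on
    separate factors. Its noise part is the t-th partial sum of one series that does not change with
    \<open>t\<close>.\<close>
  define W where "W t w = \<Phi> t (\<eta> 0 (fst w), noise (int t) (snd w))" for t :: nat and w
  have [measurable]: "W t \<in> borel_measurable (M \<Otimes>\<^sub>M M)" for t
    unfolding W_def by measurable
  have W_eq: "W t w x $ i = u x $ i + A t (x, i) (fst w)
      + (\<Sum>k<t. grad p k (\<lambda>z. \<xi> (- int k) z (snd w)) x i)" for t w x i
    unfolding W_def \<Phi>_def A_def using init by (simp add: D_noise)
  define L where "L \<omega> = (\<lambda>x. \<chi> i. u x $ i + Delta0 p \<xi> \<omega> x i)" for \<omega>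
  have [measurable]: "L \<in> borel_measurable M"
    unfolding L_def by (rule borel_measurable_config) (simp add: borel_measurable_add Delta0_measurable)

  have A_int: "integrable M (A t c)" for t c
    unfolding A_def using zeta_mean by (intro integrable_funpow_avg) auto
  have A_lim: "(\<lambda>t. \<integral>\<omega>. \<bar>A t c \<omega>\<bar> \<partial>M) \<longlonglongrightarrow> 0" for c
  proof -
    obtain x i where c: "c = (x, i)" by force
    have "(\<lambda>t. \<integral>c. \<bar>(avg p ^^ t) (\<lambda>y. c y $ i) x\<bar> \<partial>distr M borel \<zeta>) \<longlonglongrightarrow> 0"
      using zeta_mean
      by (intro stationary_ergodic_average p zeta_inv zeta_erg prob_space_distr)
         (simp_all add: integrable_distr_eq integral_distr)
    moreover have "(\<integral>c. \<bar>(avg p ^^ t) (\<lambda>y. c y $ i) x\<bar> \<partial>distr M borel \<zeta>) = (\<integral>\<omega>. \<bar>A t c \<omega>\<bar> \<partial>M)" for t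
      unfolding A_def c fst_conv snd_conv
      by (intro integral_distr borel_measurable_abs borel_measurable_funpow_avg) measurable
    ultimately show ?thesis by simp
  qed

  show ?thesis unfolding weak_conv_def
  proof (intro allI impI)
    fix f :: "'d config \<Rightarrow> real"
    assume f: "continuous_on UNIV f \<and> bounded (range f)"
    then have [measurable]: "f \<in> borel_measurable borel"
      by (intro borel_measurable_continuous_onI) auto
    obtain B where B: "\<And>c. norm (f c) \<le> B" using f by (auto simp: bounded_iff)
    have \<mu>: "integral\<^sup>L (distr M borel (\<eta> t)) f = (\<integral>w. f (W t w) \<partial>(M \<Otimes>\<^sub>M M))" for t
    proof -
      have "integral\<^sup>L (distr M borel (\<eta> t)) f = (\<integral>\<omega>. f (\<Phi> t (\<eta> 0 \<omega>, noise 0 \<omega>)) \<partial>M)"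
        unfolding \<eta>_eq[symmetric] by (rule integral_distr) measurable
      also have "\<dots> = (\<integral>w. f (W t w) \<partial>(M \<Otimes>\<^sub>M M))"
        unfolding W_def
        by (rule integral_config_noise[where H="\<lambda>h. f (\<Phi> t h)", OF eta0_meas indep0]) measurable
      finally show ?thesis .
    qed
    \<comment> \<open>Through these marginals, almost sure statements on one factor carry over to
      the product.\<close>
    have fst: "distr (M \<Otimes>\<^sub>M M) M fst = M" by (rule distr_pair_fst)
    have snd: "distr (M \<Otimes>\<^sub>M M) M snd = M" by (rule distr_pair_snd) unfold_locales
    have "integral\<^sup>L (pi_u M p \<xi> u) f = (\<integral>\<omega>. f (L \<omega>) \<partial>M)"
      unfolding pi_u_def L_def[symmetric] by (rule integral_distr) measurable
    also have "\<dots> = (\<integral>\<omega>. f (L \<omega>) \<partial>distr (M \<Otimes>\<^sub>M M) M snd)" by (simp add: snd)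
    also have "\<dots> = (\<integral>w. f (L (snd w)) \<partial>(M \<Otimes>\<^sub>M M))"
      by (rule integral_distr) measurable
    finally have \<pi>: "integral\<^sup>L (pi_u M p \<xi> u) f = (\<integral>w. f (L (snd w)) \<partial>(M \<Otimes>\<^sub>M M))" .
    show "(\<lambda>t. integral\<^sup>L (distr M borel (\<eta> t)) f) \<longlonglongrightarrow> integral\<^sup>L (pi_u M p \<xi> u) f"
      unfolding \<mu> \<pi>
    \<comment> \<open>The averaged initial fluctuation is known to vanish in L1, hence almost surely
      along a further subsequence. The partial sums of \<open>Delta0\<close> converge almost surely
      along any index sequence tending to infinity.\<close>
    proof (rule LIMSEQ_via_subseq)
      fix s :: "nat \<Rightarrow> nat" assume s: "\<And>n. n \<le> s n"
      obtain r where r: "\<And>n. n \<le> r n" and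
        AE_A: "AE \<omega> in M. \<forall>c. (\<lambda>n. A (s (r n)) c \<omega>) \<longlonglongrightarrow> 0"
        using AE_subseq_countable[of M "\<lambda>n. A (s n)", OF A_int
            filterlim_compose[OF A_lim filterlim_ge_id[OF s]]] by blast
      have sr: "filterlim (\<lambda>n. s (r n)) at_top sequentially"
        using s r by (intro filterlim_ge_id) (meson order_trans)
      have "AE \<omega> in distr (M \<Otimes>\<^sub>M M) M fst. \<forall>c. (\<lambda>n. A (s (r n)) c \<omega>) \<longlonglongrightarrow> 0"
        unfolding fst by (rule AE_A)
      then have 1: "AE w in M \<Otimes>\<^sub>M M. \<forall>c. (\<lambda>n. A (s (r n)) c (fst w)) \<longlonglongrightarrow> 0"
        by (rule AE_distrD[OF measurable_fst])
      have "AE \<omega> in M. \<forall>c. summable (\<lambda>k. grad p k (\<lambda>z. \<xi> (- int k) z \<omega>) (fst c) (snd c))"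
        unfolding AE_all_countable by (intro allI AE_summable_Delta0)
      then have "AE \<omega> in distr (M \<Otimes>\<^sub>M M) M snd. \<forall>c. summable (\<lambda>k. grad p k (\<lambda>z. \<xi> (- int k) z \<omega>) (fst c) (snd c))"
        unfolding snd .
      then have 2: "AE w in M \<Otimes>\<^sub>M M. \<forall>c. summable (\<lambda>k. grad p k (\<lambda>z. \<xi> (- int k) z (snd w)) (fst c) (snd c))"
        by (rule AE_distrD[OF measurable_snd])
      have "(\<lambda>n. \<integral>w. f (W (s (r n)) w) \<partial>(M \<Otimes>\<^sub>M M)) \<longlonglongrightarrow> (\<integral>w. f (L (snd w)) \<partial>(M \<Otimes>\<^sub>M M))"
      \<comment> \<open>In the product topology coordinatewise convergence suffices for the
        continuous \<open>f\<close>, and its bound \<open>B\<close> dominates.\<close>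
      proof (rule integral_dominated_convergence[where w="\<lambda>_. B"])
        show "AE w in M \<Otimes>\<^sub>M M. (\<lambda>n. f (W (s (r n)) w)) \<longlonglongrightarrow> f (L (snd w))"
          using 1 2
        proof eventually_elim
          case (elim w)
          have "(\<lambda>n. W (s (r n)) w) \<longlonglongrightarrow> L (snd w)"
          proof (rule tendsto_config)
            fix x i
            have "(\<lambda>n. \<Sum>k<s (r n). grad p k (\<lambda>z. \<xi> (- int k) z (snd w)) x i) \<longlonglongrightarrow> Delta0 p \<xi> (snd w) x i"
              unfolding Delta0_eq[OF walk_axioms]
              using elim(2)[rule_format, of "(x, i)"]
              by (intro filterlim_compose[OF summable_LIMSEQ sr]) simp
            then have "(\<lambda>n. W (s (r n)) w x $ i) \<longlonglongrightarrow> u x $ i + 0 + Delta0 p \<xi> (snd w) x i"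
              unfolding W_eq by (intro tendsto_intros elim(1)[rule_format])
            then show "(\<lambda>n. W (s (r n)) w x $ i) \<longlonglongrightarrow> L (snd w) x $ i" by (simp add: L_def)
          qed
          then show ?case
            using f by (intro continuous_on_tendsto_compose[of UNIV f]) auto
        qed
      qed (use B in \<open>auto intro!: P.integrable_const\<close>)
      then show "\<exists>r. (\<lambda>n. \<integral>w. f (W (s (r n)) w) \<partial>(M \<Otimes>\<^sub>M M)) \<longlonglongrightarrow> (\<integral>w. f (L (snd w)) \<partial>(M \<Otimes>\<^sub>M M))"
        by blast
    qed
  qed
qed

end
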